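(* The randomized mechanism Algorithm 2 is (universally) truthful: for each of its two branches, for every user $A_i$ with true data $(\hat d_i,\hat s_i,\hat e_i)$, every bid $b_i=(d_i,s_i,e_i)$ of $A_i$ and every vector $b_{-i}$ of bids of the other users, the utility of $A_i$ when bidding $(\hat d_i,\hat s_i,\hat e_i)$ is at least his utility when bidding $b_i$.
   Context: MCS setting. There are $m$ tasks; performing task $k$ has value $u_k>0$ per unit time. There are $n$ users $A_1,\dots,A_n$ (set $\mathcal A$); user $A_i$ can perform exactly one, publicly known, task $\kappa_i$; put $\mu_i=u_{\kappa_i}$. The budget is $G>0$. User $A_i$ has private true data: cost per unit time $\hat d_i>0$ and availability $[\hat s_i,\hat e_i]$ with integers $\hat s_i<\hat e_i$. He submits a bid $b_i=(d_i,s_i,e_i)$ with real $d_i>0$ and integers $s_i<e_i$; $T_i=[s_i,e_i]$; $\vec b=(b_1,\dots,b_n)$. A schedule is $\vec y=(y_1,\dots,y_n)$ with $y_i\subseteq T_i$ a finite union of intervals; $|\cdot|$ is total length; a time unit is an interval $[t,t+1]$, $t\in\mathbb Z$; sets are considered up to measure zero. The revenue is $R(\vec y)=\sum_{k=1}^m u_k\lfloor|\bigcup_{j:\kappa_j=k}y_j|\rfloor$. Utility and post-paid scheme. The payment $p_i(\vec b)$ is handed to $A_i$ at time $e_i$ (the end of his declared period) and only if he has completed sensing during all of $y_i(\vec b)$. Hence if $y_i(\vec b)\not\subseteq[\hat s_i,\hat e_i]$ or $e_i\notin[\hat s_i,\hat e_i]$, the payment actually received is $0$; otherwise it is $p_i(\vec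 b)$. The utility of $A_i$ is (payment actually received) $-\,\hat d_i|y_i(\vec b)|$. A randomized mechanism is called (universally) truthful if it is a randomization over mechanisms in each of which truthful bidding maximizes each user's utility whatever the others bid. Order: $A_i\prec A_j$ iff $\mu_i/d_i<\mu_j/d_j$, or $\mu_i/d_i=\mu_j/d_j$ and $j>i$. Algorithm 1 (ApproxMCS). Start with $\mathcal D=\mathcal A$, $\mathcal W=\emptyset$, all $y_i=\emptyset$. Repeat: let $A_j$ be the $\prec$-maximum of $\mathcal D$; $Z_j=T_j\setminus\bigcup_{i:\kappa_i=\kappa_j}y_i$; $q=\min\{|Z_j|,\lfloor\frac{G}{2d_j}-\frac{R(\vec y)}{\mu_j}\rfloor\}$; if $q>0$: add $j$ to $\mathcal W$, set $y_j$ to the first (earliest) $q$ time units of $Z_j$, and remove from $\mathcal D$ all $A_i$ with $T_i\subseteq\bigcup_{\ell:\kappa_\ell=\kappa_i}y_\ell$; until $q<|Z_j|$ or $\mathcal D=\emptyset$. Return $\vec y$ and $\mathcal W=\{n_1,\dots,n_h\}$, indexed in order of selection. Algorithm 3 (CalPayment for $n_i\in\mathcal W$). Set $t_{n_j}=y_{n_j}$ for $1\le j\le i-1$ and all other $t_j=\emptyset$; $\mathcal S=\{j: A_j\prec A_{n_i}\}$; $p_{n_i}=d_{n_i}|y_{n_i}|$; $k=n_i$; $\theta=|\mathcal S|$. While $\theta\ge0$: (a) $\mathcal Z_1=T_{n_i}\setminus\bigcup_{\ell:\kappa_\ell=\kappa_{n_i}}t_\ell$, $\gamma_1=\frac{\mu_{n_i}}{\mu_k}d_k$,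 $\gamma_2=\frac{\mu_{n_i}G}{2R(\vec t)}$ ($=+\infty$ if $R(\vec t)=0$); if $\mathcal S\ne\emptyset$, let $A_j$ be the $\prec$-maximal user with index in $\mathcal S$ and replace $\gamma_2$ by $\min\{\frac{\mu_{n_i}}{\mu_j}d_j,\gamma_2\}$. (b) If $|\mathcal Z_1|>0$ and $\gamma_2\ge\gamma_1$, add $\int_{\gamma_1}^{\gamma_2}\min\{|\mathcal Z_1|,\lfloor\frac{G}{2v}-\frac{R(\vec t)}{\mu_{n_i}}\rfloor\}\,dv$ to $p_{n_i}$; otherwise exit the loop. (c) If $\mathcal S\neq\emptyset$: $\mathcal Z_2=T_j\setminus\bigcup_{\ell:\kappa_\ell=\kappa_j}t_\ell$, $q=\min\{|\mathcal Z_2|,\lfloor\frac{G}{2d_j}-\frac{R(\vec t)}{\mu_j}\rfloor\}$; if $q>0$ set $t_j$ to the first $q$ time units of $\mathcal Z_2$; if $q<|\mathcal Z_2|$ exit the loop; then set $k=j$, $\theta=|\mathcal S|$, and remove $j$ from $\mathcal S$. (d) $\theta\leftarrow\theta-1$. Return $p_{n_i}$. Algorithm 2 (offline mechanism). With probability $1/2$ (branch 1): compute $(\vec y,\mathcal W)$ by Algorithm 1, the payment of each $n_i\in\mathcal W$ is the amount computed by Algorithm 3 and other users have payment $0$. Otherwise (branch 2): let $j=\arg\max_{i:d_i\le G}\mu_i$ (ties broken by a fixed index rule; nobody is selected if no $d_i\le G$), let $y_j$ be an arbitrary single time unit of $T_j$, all other $y_i=\emptyset$, $p_j=G$, all other payments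 $0$. Payments are executed by the post-paid scheme. *)

theory Defs
  imports "HOL-Probability.Probability" "HOL-Library.While_Combinator"
begin

section \<open>Time\<close>

definition len :: "real set \<Rightarrow> real" where
  "len A = measure lborel A"

text \<open>Inclusion up to measure zero.\<close>

definition ess_subset :: "real set \<Rightarrow> real set \<Rightarrow> bool"  (infix "\<sqsubseteq>" 50) where
  "A \<sqsubseteq> B \<longleftrightarrow> A - B \<in> null_sets lborel"

definition time_unit :: "int \<Rightarrow> real set" where
  "time_unit t = {real_of_int t .. real_of_int t + 1}"

text \<open>
  The union of the earliest \<open>q\<close> time units contained in \<open>Z\<close>.  The number \<open>q\<close> is a real only because
  it arises as a minimum of a length and an integer; all lengths that occur are integers.
\<close>

definition first_units :: "real \<Rightarrow> real set \<Rightarrow> real set" where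
  "first_units q Z =
     (\<Union>t\<in>{t. time_unit t \<sqsubseteq> Z \<and> real (card {t'. t' < t \<and> time_unit t' \<sqsubseteq> Z}) < q}. time_unit t)"


section \<open>Bids and mechanisms\<close>

text \<open>The same type serves for submitted bids and for the private true data.\<close>

datatype bid = Bid (cost: real) (arrival: int) (departure: int)

definition valid_bid :: "bid \<Rightarrow> bool" where
  "valid_bid \<beta> \<longleftrightarrow> 0 < cost \<beta> \<and> arrival \<beta> < departure \<beta>"

definition window :: "bid \<Rightarrow> real set" where
  "window \<beta> = {real_of_int (arrival \<beta>) .. real_of_int (departure \<beta>)}"

type_synonym bids = "nat \<Rightarrow> bid"
type_synonym schedule = "nat \<Rightarrow> real set"

text \<open>A deterministic mechanism maps the bids to a schedule and to promised payments.\<close>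

type_synonym mechanism = "bids \<Rightarrow> schedule \<times> (nat \<Rightarrow> real)"

text \<open>
  Post-paid scheme: \<open>\<theta>\<close> is the true data of user \<open>i\<close>, and \<open>p i\<close> is paid out at the declared
  departure time, provided that user \<open>i\<close> is then present and could serve all of \<open>y i\<close>.
\<close>

definition received :: "mechanism \<Rightarrow> nat \<Rightarrow> bid \<Rightarrow> bids \<Rightarrow> real" where
  "received M i \<theta> b =
     (let (y, p) = M b in
        if y i \<sqsubseteq> window \<theta> \<and> real_of_int (departure (b i)) \<in> window \<theta> then p i else 0)"

definition utility :: "mechanism \<Rightarrow> nat \<Rightarrow> bid \<Rightarrow> bids \<Rightarrow> real" where
  "utility M i \<theta> b = received M i \<theta> b - cost \<theta> * len (fst (M b) i)"

definition valid_bids :: "nat \<Rightarrow> bids \<Rightarrow> bool" where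
  "valid_bids n b \<longleftrightarrow> (\<forall>i\<in>{1..n}. valid_bid (b i))"

definition truthful :: "nat \<Rightarrow> mechanism \<Rightarrow> bool" where
  "truthful n M \<longleftrightarrow>
     (\<forall>b i \<theta>. valid_bids n b \<longrightarrow> i \<in> {1..n} \<longrightarrow> valid_bid \<theta> \<longrightarrow>
        utility M i \<theta> b \<le> utility M i \<theta> (b(i := \<theta>)))"

definition universally_truthful :: "nat \<Rightarrow> mechanism pmf \<Rightarrow> bool" where
  "universally_truthful n P \<longleftrightarrow> (\<forall>M\<in>set_pmf P. truthful n M)"


section \<open>The mechanism\<close>

text \<open>
  Tasks are \<open>1..m\<close> with values \<open>u\<close>, users are \<open>1..n\<close>, user \<open>i\<close> performs task \<open>\<kappa> i\<close>, and the
  budget is \<open>G\<close>.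
\<close>

locale mcs =
  fixes m n :: nat and \<kappa> :: "nat \<Rightarrow> nat" and u :: "nat \<Rightarrow> real" and G :: real
  assumes task_range: "\<And>i. i \<in> {1..n} \<Longrightarrow> \<kappa> i \<in> {1..m}"
    and value_pos: "\<And>k. k \<in> {1..m} \<Longrightarrow> 0 < u k"
    and budget_pos: "0 < G"
begin

definition \<mu> :: "nat \<Rightarrow> real" where
  "\<mu> i = u (\<kappa> i)"

definition covered :: "schedule \<Rightarrow> nat \<Rightarrow> real set" where
  "covered y k = (\<Union>j\<in>{j\<in>{1..n}. \<kappa> j = k}. y j)"

definition revenue :: "schedule \<Rightarrow> real" where
  "revenue y = (\<Sum>k = 1..m. u k * of_int \<lfloor>len (covered y k)\<rfloor>)"

definition prec :: "bids \<Rightarrow> nat \<Rightarrow> nat \<Rightarrow> bool" where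
  "prec b i j \<longleftrightarrow>
     \<mu> i / cost (b i) < \<mu> j / cost (b j) \<or>
     \<mu> i / cost (b i) = \<mu> j / cost (b j) \<and> j > i"

definition prec_max :: "bids \<Rightarrow> nat set \<Rightarrow> nat" where
  "prec_max b A = (THE j. j \<in> A \<and> (\<forall>i\<in>A. i \<noteq> j \<longrightarrow> prec b i j))"

text \<open>The sets called \<open>Z\<close> in the algorithms, and the number \<open>q\<close> of time units to be assigned.\<close>

definition free :: "bids \<Rightarrow> schedule \<Rightarrow> nat \<Rightarrow> real set" where
  "free b y j = window (b j) - covered y (\<kappa> j)"

definition quota :: "bids \<Rightarrow> schedule \<Rightarrow> nat \<Rightarrow> real" where
  "quota b y j =
     min (len (free b y j)) (of_int \<lfloor>G / (2 * cost (b j)) - revenue y / \<mu> j\<rfloor>)"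


subsection \<open>Algorithm ApproxMCS\<close>

text \<open>
  The state is \<open>(D, W, y, halt)\<close>; the list \<open>W\<close> holds the selected users in order of selection, and
  \<open>halt\<close> records that \<open>q < |Z|\<close> held in the last iteration.
\<close>

definition approx_step ::
  "bids \<Rightarrow> nat set \<times> nat list \<times> schedule \<times> bool \<Rightarrow> nat set \<times> nat list \<times> schedule \<times> bool" where
  "approx_step b = (\<lambda>(D, W, y, halt).
     let j = prec_max b D; Z = free b y j; q = quota b y j in
     if q > 0 then
       let y' = y(j := first_units q Z) in
         ({i\<in>D. \<not> window (b i) \<sqsubseteq> covered y' (\<kappa> i)}, W @ [j], y', q < len Z)
     else (D, W, y, q < len Z))"

definition approx_mcs :: "bids \<Rightarrow> schedule \<times> nat list" where
  "approx_mcs b =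
     (let (D, W, y, halt) =
        while (\<lambda>(D, W, y, halt). \<not> halt \<and> D \<noteq> {}) (approx_step b) ({1..n}, [], \<lambda>_. {}, False)
      in (y, W))"


subsection \<open>Algorithm CalPayment\<close>

text \<open>
  The state is \<open>(t, S, p, k, \<theta>, halt)\<close>, where \<open>halt\<close> records that the loop has been left from
  inside its body.
\<close>

definition pay_step ::
  "bids \<Rightarrow> nat \<Rightarrow> schedule \<times> nat set \<times> real \<times> nat \<times> int \<times> bool
     \<Rightarrow> schedule \<times> nat set \<times> real \<times> nat \<times> int \<times> bool" where
  "pay_step b i = (\<lambda>(t, S, p, k, \<theta>, halt).
     let j = prec_max b S;
         Z\<^sub>1 = free b t i;
         \<gamma>\<^sub>1 = \<mu> i / \<mu> k * cost (b k);
         \<gamma> = (if revenue t = 0 then \<infinity> else ereal (\<mu> i * G / (2 * revenue t)));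
         \<gamma>\<^sub>2 = (if S \<noteq> {} then min (ereal (\<mu> i / \<mu> j * cost (b j))) \<gamma> else \<gamma>)
     in if len Z\<^sub>1 > 0 \<and> \<gamma>\<^sub>2 \<ge> ereal \<gamma>\<^sub>1 then
          let p' = p + (LBINT v = ereal \<gamma>\<^sub>1 .. \<gamma>\<^sub>2.
                          min (len Z\<^sub>1) (of_int \<lfloor>G / (2 * v) - revenue t / \<mu> i\<rfloor>))
          in if S \<noteq> {} then
               let Z\<^sub>2 = free b t j;
                   q = quota b t j;
                   t' = (if q > 0 then t(j := first_units q Z\<^sub>2) else t)
               in if q < len Z\<^sub>2 then (t', S, p', k, \<theta>, True)
                  else (t', S - {j}, p', j, int (card S) - 1, False)
             else (t, S, p', k, \<theta> - 1, False)
        else (t, S, p, k, \<theta>, True))"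

definition cal_payment :: "bids \<Rightarrow> schedule \<Rightarrow> nat list \<Rightarrow> nat \<Rightarrow> real" where
  "cal_payment b y W i =
     (let t\<^sub>0 = (\<lambda>l. if l \<in> set (takeWhile (\<lambda>l. l \<noteq> i) W) then y l else {});
          S\<^sub>0 = {j\<in>{1..n}. prec b j i};
          (t, S, p, k, \<theta>, halt) =
            while (\<lambda>(t, S, p, k, \<theta>, halt). \<not> halt \<and> \<theta> \<ge> 0) (pay_step b i)
              (t\<^sub>0, S\<^sub>0, cost (b i) * len (y i), i, int (card S\<^sub>0), False)
      in p)"


subsection \<open>The offline mechanism\<close>

definition greedy_branch :: mechanism where
  "greedy_branch b =
     (let (y, W) = approx_mcs b in
        (y, \<lambda>i. if i \<in> set W then cal_payment b y W i else 0))"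

text \<open>
  The function \<open>tie\<close> selects one user from each nonempty set of tied users, and \<open>slot b j\<close> is the
  starting time of the time unit assigned to \<open>j\<close>.
\<close>

definition single_branch :: "(nat set \<Rightarrow> nat) \<Rightarrow> (bids \<Rightarrow> nat \<Rightarrow> int) \<Rightarrow> mechanism" where
  "single_branch tie slot b =
     (let A = {i. is_arg_max \<mu> (\<lambda>i. i \<in> {1..n} \<and> cost (b i) \<le> G) i} in
        if A = {} then (\<lambda>_. {}, \<lambda>_. 0)
        else ((\<lambda>_. {})(tie A := time_unit (slot b (tie A))), (\<lambda>_. 0)(tie A := G)))"

definition offline_mechanism ::
  "(nat set \<Rightarrow> nat) \<Rightarrow> (bids \<Rightarrow> nat \<Rightarrow> int) \<Rightarrow> mechanism pmf" where
  "offline_mechanism tie slot =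
     map_pmf (\<lambda>c. if c then greedy_branch else single_branch tie slot) (bernoulli_pmf (1/2))"

end

end

theory Submission
  imports Defs
begin

text \<open>
  For the greedy branch this is Myerson's argument.  Fix the bids of the others and let \<open>x v\<close> be the
  number of units that user \<open>i\<close> gets when he declares cost \<open>v\<close>.  Raising \<open>v\<close> only moves him to a later
  point of one and the same greedy run of the others, where less is free and less budget is left;
  so \<open>x\<close> is decreasing, and CalPayment, which continues that run, computes
  \<open>d * x d + \<integral>\<^sub>d\<^sup>\<infinity> x v dv\<close> for the declared cost \<open>d\<close>.  Declaring another window cannot increase
  \<open>x\<close> at any \<open>v \<ge> d\<close> unless the post-paid scheme withholds the payment, and monotonicity settles the
  choice of the cost.
\<close>

section \<open>Unions of time units\<close>

text \<open>The competitors of user \<open>i\<close> are kept in one priority list that omits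
  \<open>i\<close>. Neither his cost nor his window enters it, so the same list serves every
  declared cost and both reports; his cost only fixes where he is inserted.

  Measure theory is confined to the beginning: closed time units overlap in endpoints only, so up to
  a null set all schedules become finite sets of integers and lengths become cardinalities.

  The two algorithms disagree about a competitor whose window is already covered: ApproxMCS discards
  him, whereas CalPayment stops if his quota is negative. The integral formula survives because the
  budget left for \<open>i\<close> is then exhausted at all higher costs.

  The curves for two declared windows can be compared only at costs \<open>v\<close> \<ge>
  \<open>d\<close>: the comparison rests on the first unit assigned at the declared cost
  \<open>d\<close>, and only the schedules met at higher costs are known to extend the one met at
  \<open>d\<close>. Hence the final estimate distinguishes whether the true cost lies below or above
  \<open>d\<close>.\<close>

definition units :: "int set \<Rightarrow> real set" where
  "units T = (\<Union>t\<in>T. time_unit t)"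

lemma units_empty [simp]: "units {} = {}"
  by (simp add: units_def)

text \<open>Neighbouring closed units share an endpoint, so a point determines its unit only off
  \<open>\<int>\<close>. Since \<open>\<int>\<close> is a null set, this is enough for all
  statements about lengths and essential inclusion.\<close>

lemma units_iff_floor:
  assumes "x \<notin> \<int>"
  shows "x \<in> units T \<longleftrightarrow> \<lfloor>x\<rfloor> \<in> T"
proof -
  have "x \<in> time_unit t \<longleftrightarrow> \<lfloor>x\<rfloor> = t" for t
  proof
    assume "x \<in> time_unit t"
    moreover have "x \<noteq> real_of_int t" "x \<noteq> real_of_int (t + 1)"
      using assms Ints_of_int by metis+
    ultimately show "\<lfloor>x\<rfloor> = t"
      by (auto simp: time_unit_def floor_eq_iff)
  next
    assume "\<lfloor>x\<rfloor> = t"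
    then show "x \<in> time_unit t"
      by (simp add: time_unit_def floor_eq_iff)
  qed
  then show ?thesis
    by (auto simp: units_def)
qed

lemma units_measurable [measurable, simp]: "units T \<in> sets borel"
  unfolding units_def time_unit_def by (rule sets.countable_UN') auto

lemma Ints_null: "(\<int> :: real set) \<in> null_sets lborel"
  by (intro countable_imp_null_set_lborel) (auto simp: Ints_def)

lemma window_units: "valid_bid \<beta> \<Longrightarrow> window \<beta> = units {arrival \<beta> ..< departure \<beta>}"
proof (intro equalityI subsetI)
  fix x assume "valid_bid \<beta>" "x \<in> window \<beta>"
  then show "x \<in> units {arrival \<beta> ..< departure \<beta>}"
  proof (cases "x = departure \<beta>")
    case True
    with \<open>valid_bid \<beta>\<close> show ?thesis
      unfolding units_def time_unit_def valid_bid_def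
      by (intro UN_I[of "departure \<beta> - 1"]) auto
  next
    case False
    with \<open>x \<in> window \<beta>\<close> have "real_of_int (arrival \<beta>) \<le> x" "x < real_of_int (departure \<beta>)"
      by (auto simp: window_def)
    then have "\<lfloor>x\<rfloor> \<in> {arrival \<beta> ..< departure \<beta>}"
      by (auto simp: le_floor_iff floor_less_iff)
    then show ?thesis
      unfolding units_def time_unit_def by (intro UN_I[of "\<lfloor>x\<rfloor>"]) auto
  qed
next
  fix x assume "x \<in> units {arrival \<beta> ..< departure \<beta>}"
  then obtain t where "arrival \<beta> \<le> t" "t + 1 \<le> departure \<beta>" "real_of_int t \<le> x" "x \<le> real_of_int (t + 1)"
    by (auto simp: units_def time_unit_def)
  then show "x \<in> window \<beta>"
    unfolding window_def atLeastAtMost_iff by (meson of_int_le_iff order_trans)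
qed

text \<open>Off \<open>\<int>\<close> the difference agrees with the union of the half-open units
  over \<open>A - B\<close>. These are disjoint, so the measure is a sum of ones.\<close>

lemma len_units_diff:
  assumes "finite A"
  shows "len (units A - units B) = card (A - B)"
proof -
  let ?C = "\<Union>t\<in>A - B. {real_of_int t ..< real_of_int t + 1}"
  have "AE x in lborel. x \<in> units A - units B \<longleftrightarrow> x \<in> ?C"
    using AE_not_in[OF Ints_null]
  proof eventually_elim
    case (elim x)
    have "x \<in> ?C \<longleftrightarrow> \<lfloor>x\<rfloor> \<in> A - B"
      by (auto simp: floor_eq_iff intro!: bexI[of _ "\<lfloor>x\<rfloor>"]) (metis floor_unique)+
    with elim show ?case
      by (simp add: units_iff_floor)
  qed
  then have "len (units A - units B) = measure lborel ?C"
    unfolding len_def using assms by (intro measure_eq_AE) auto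
  also have "\<dots> = (\<Sum>t\<in>A - B. measure lborel {real_of_int t ..< real_of_int t + 1})"
    using assms
    by (intro measure_finite_Union) (auto simp: disjoint_family_on_def)
  finally show ?thesis
    by simp
qed

lemma len_units: "finite A \<Longrightarrow> len (units A) = card A"
  using len_units_diff[of A "{}"] by simp

lemma units_ess_subset:
  assumes "A \<subseteq> B - C"
  shows "units A \<sqsubseteq> units B - units C"
  unfolding ess_subset_def
proof (rule null_sets_subset[OF Ints_null])
  show "units A - (units B - units C) \<subseteq> \<int>"
    using assms units_iff_floor by fastforce
qed simp

text \<open>For \<open>t\<close> in \<open>A - B\<close> the open interval from \<open>t\<close> to
  \<open>t + 1\<close> would lie in the exceptional null set, but it has length 1.\<close>

lemma ess_subset_unitsD:
  assumes "units A \<sqsubseteq> units B"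
  shows "A \<subseteq> B"
proof
  fix t assume "t \<in> A"
  show "t \<in> B"
  proof (rule ccontr)
    assume "t \<notin> B"
    have fl: "\<lfloor>x\<rfloor> = t" "x \<notin> \<int>" if "x \<in> {real_of_int t<..<real_of_int t + 1}" for x
    proof -
      show "\<lfloor>x\<rfloor> = t"
        using that by (auto simp: floor_eq_iff)
      then show "x \<notin> \<int>"
        using that by (auto elim!: Ints_cases)
    qed
    have "{real_of_int t<..<real_of_int t + 1} \<subseteq> units A - units B"
      using fl \<open>t \<in> A\<close> \<open>t \<notin> B\<close> units_iff_floor by auto
    then have "{real_of_int t<..<real_of_int t + 1} \<in> null_sets lborel"
      using assms unfolding ess_subset_def by (rule null_sets_subset[rotated 2]) simp
    then show False
      by (simp add: null_sets_def)
  qed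
qed

lemma units_subsetD:
  assumes "units A \<subseteq> units B"
  shows "A \<subseteq> B"
  using assms by (intro ess_subset_unitsD) (simp add: ess_subset_def Diff_eq_empty_iff[THEN iffD2])

text \<open>The inclusion has to be essential: removing \<open>units B\<close> also removes
  endpoints of adjacent units, so a unit over \<open>A - B\<close> need not be a literal
  subset.\<close>

lemma time_unit_ess_subset_iff: "time_unit t \<sqsubseteq> units A - units B \<longleftrightarrow> t \<in> A - B"
proof
  have u: "units {t} = time_unit t"
    by (simp add: units_def)
  assume *: "time_unit t \<sqsubseteq> units A - units B"
  have "units {t} \<sqsubseteq> units A"
    using * unfolding u ess_subset_def by (rule null_sets_subset) (auto simp: u[symmetric])
  then have "t \<in> A"
    using ess_subset_unitsD by blast
  moreover have "t \<notin> B"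
  proof
    assume "t \<in> B"
    then have "time_unit t \<subseteq> units B"
      by (auto simp: units_def)
    then have "time_unit t - (units A - units B) = units {t} - units {}"
      by (auto simp: u)
    with * have "units {t} \<sqsubseteq> units {}"
      by (simp add: ess_subset_def)
    then show False
      using ess_subset_unitsD by blast
  qed
  ultimately show "t \<in> A - B" by blast
next
  assume "t \<in> A - B"
  then show "time_unit t \<sqsubseteq> units A - units B"
    using units_ess_subset[of "{t}" A B] by (simp add: units_def)
qed

section \<open>Earliest elements of a finite set of integers\<close>

definition first_elems :: "real \<Rightarrow> int set \<Rightarrow> int set" where
  "first_elems q F = {t\<in>F. real (card {t'\<in>F. t' < t}) < q}"

lemma first_units_diff: "first_units q (units A - units B) = units (first_elems q (A - B))"
  unfolding first_units_def time_unit_ess_subset_iff first_elems_def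
  by (auto simp: units_def conj_commute)

text \<open>Counting smaller elements is strictly increasing on \<open>F\<close> and takes values
  below \<open>card F\<close>; an injection between finite sets of equal size is onto.\<close>

lemma bij_betw_rank:
  fixes F :: "'a::linorder set"
  assumes "finite F"
  shows "bij_betw (\<lambda>t. card {t'\<in>F. t' < t}) F {..<card F}"
proof -
  let ?r = "\<lambda>t. card {t'\<in>F. t' < t}"
  have mono: "?r s < ?r t" if "s \<in> F" "s < t" for s t
    using that assms by (intro psubset_card_mono) auto
  have inj: "inj_on ?r F"
    by (rule linorder_inj_onI) (use mono in fastforce)+
  moreover have "?r ` F = {..<card F}"
  proof (rule card_subset_eq)
    show "?r ` F \<subseteq> {..<card F}"
      using assms by (auto intro!: psubset_card_mono)
  qed (auto simp: card_image inj)
  ultimately show ?thesis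
    by (simp add: bij_betw_def)
qed

lemma card_first_elems:
  assumes "finite F" "k \<le> card F"
  shows "card (first_elems (real k) F) = k"
proof -
  have b: "bij_betw (\<lambda>t. card {t'\<in>F. t' < t}) F {..<card F}"
    using assms(1) by (rule bij_betw_rank)
  have "bij_betw (\<lambda>t. card {t'\<in>F. t' < t}) (first_elems (real k) F) {..<k}"
  proof -
    have "(\<lambda>t. card {t'\<in>F. t' < t}) ` first_elems (real k) F = {..<k}"
    proof (intro equalityI subsetI)
      fix x assume "x \<in> {..<k}"
      then have "x \<in> (\<lambda>t. card {t'\<in>F. t' < t}) ` F"
        using b assms(2) by (auto simp: bij_betw_def)
      with \<open>x \<in> {..<k}\<close> show "x \<in> (\<lambda>t. card {t'\<in>F. t' < t}) ` first_elems (real k) F"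
        by (auto simp: first_elems_def)
    qed (auto simp: first_elems_def)
    moreover have "first_elems (real k) F \<subseteq> F"
      by (auto simp: first_elems_def)
    ultimately show ?thesis
      using b by (auto simp: bij_betw_def intro: inj_on_subset)
  qed
  then show ?thesis
    by (auto dest: bij_betw_same_card)
qed

lemma first_elems_subset: "first_elems q F \<subseteq> F"
  by (auto simp: first_elems_def)

text \<open>The minimum of \<open>F\<close> has rank 0, so every positive \<open>q\<close> selects
  it. This later prevents a user from gaining by declaring too early an arrival.\<close>

lemma first_elems_least:
  assumes "q > 0" "t \<in> F" "finite F"
  shows "\<exists>s\<in>first_elems q F. s \<le> t"
proof (intro bexI)
  have "card {t'\<in>F. t' < Min F} = 0"
    using assms(3) by (auto simp: card_eq_0_iff not_less)
  moreover have "Min F \<in> F"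
    using assms by (intro Min_in) auto
  ultimately show "Min F \<in> first_elems q F"
    using assms(1) by (simp only: first_elems_def mem_Collect_eq of_nat_0)
qed (use assms in simp)

lemma units_ess_subset_iff_len:
  assumes "finite A"
  shows "units A \<sqsubseteq> units B \<longleftrightarrow> len (units A - units B) = 0"
proof -
  have "units A \<sqsubseteq> units B \<longleftrightarrow> A \<subseteq> B"
    using ess_subset_unitsD[of A B] units_ess_subset[of A B "{}"] by auto
  then show ?thesis
    using assms by (auto simp: len_units_diff)
qed

section \<open>Schedules made of whole time units\<close>

definition unit_schedule :: "schedule \<Rightarrow> bool" where
  "unit_schedule y \<longleftrightarrow> (\<forall>l. \<exists>T. finite T \<and> y l = units T)"

lemma unit_schedule_empty: "unit_schedule (\<lambda>_. {})"
  unfolding unit_schedule_def by (metis finite.emptyI units_empty)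

lemma valid_bidsD: "valid_bids n b \<Longrightarrow> j \<in> {1..n} \<Longrightarrow> valid_bid (b j)"
  by (simp add: valid_bids_def)

context mcs
begin

lemma value_positive: "j \<in> {1..n} \<Longrightarrow> 0 < \<mu> j"
  unfolding \<mu>_def by (intro value_pos task_range)

subsection \<open>Monotonicity of greedy runs\<close>

definition serve :: "bids \<Rightarrow> schedule \<Rightarrow> nat \<Rightarrow> schedule" where
  "serve b y j = (if quota b y j > 0 then y(j := first_units (quota b y j) (free b y j)) else y)"

definition blocked :: "bids \<Rightarrow> schedule \<Rightarrow> nat \<Rightarrow> bool" where
  "blocked b y j \<longleftrightarrow> 0 < len (free b y j) \<and> quota b y j < len (free b y j)"

text \<open>
  \<open>None\<close> records that the algorithm stops at a user of the list.  As in ApproxMCS, a user whose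
  window is already covered never stops it, even if his quota is negative.
\<close>

fun pass :: "bids \<Rightarrow> schedule \<Rightarrow> nat list \<Rightarrow> schedule option" where
  "pass b y [] = Some y"
| "pass b y (j # L) = (if blocked b y j then None else pass b (serve b y j) L)"

lemma pass_append: "pass b y (L @ L') = Option.bind (pass b y L) (\<lambda>t. pass b t L')"
  by (induction L arbitrary: y) auto

lemma covered_units:
  assumes "unit_schedule y"
  obtains T where "finite T" "covered y k = units T"
proof -
  obtain \<tau> where \<tau>: "\<And>l. finite (\<tau> l)" "\<And>l. y l = units (\<tau> l)"
    using assms unfolding unit_schedule_def by metis
  show thesis
    using \<tau> by (intro that[of "\<Union>j\<in>{j\<in>{1..n}. \<kappa> j = k}. \<tau> j"]) (auto simp: covered_def units_def)
qed

lemma covered_mono: "y \<le> y' \<Longrightarrow> covered y k \<subseteq> covered y' k"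
  unfolding covered_def le_fun_def by blast

lemma free_mono: "y \<le> y' \<Longrightarrow> free b y' j \<subseteq> free b y j"
  unfolding free_def using covered_mono by blast

lemma free_units:
  assumes "unit_schedule y" "valid_bid (b j)"
  obtains T where "finite T" "covered y (\<kappa> j) = units T"
    "free b y j = units {arrival (b j)..<departure (b j)} - units T"
    "len (free b y j) = card ({arrival (b j)..<departure (b j)} - T)"
  using covered_units[OF assms(1), of "\<kappa> j"] window_units[OF assms(2)]
  unfolding free_def by (metis finite_atLeastLessThan_int len_units_diff)

lemma len_free_mono:
  assumes "y \<le> y'" "unit_schedule y" "unit_schedule y'" "valid_bid (b j)"
  shows "len (free b y' j) \<le> len (free b y j)"
proof -
  obtain T T' where T: "finite T" "covered y (\<kappa> j) = units T"
      "len (free b y j) = card ({arrival (b j)..<departure (b j)} - T)"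
    and T': "covered y' (\<kappa> j) = units T'"
      "len (free b y' j) = card ({arrival (b j)..<departure (b j)} - T')"
    by (metis free_units assms(2-4))
  have "T \<subseteq> T'"
    using covered_mono[OF assms(1), of "\<kappa> j"] T T' by (simp add: units_subsetD)
  then show ?thesis
    unfolding T T' of_nat_le_iff by (intro card_mono) auto
qed

lemma revenue_mono:
  assumes "y \<le> y'" "unit_schedule y" "unit_schedule y'"
  shows "revenue y \<le> revenue y'"
  unfolding revenue_def
proof (intro sum_mono mult_left_mono)
  fix k assume "k \<in> {1..m}"
  then show "0 \<le> u k"
    using value_pos[of k] by simp
  obtain T T' where T: "finite T" "covered y k = units T" and T': "finite T'" "covered y' k = units T'"
    by (metis covered_units assms(2,3))
  have "T \<subseteq> T'"
    using covered_mono[OF assms(1), of k] T T' by (simp add: units_subsetD)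
  then have "len (covered y k) \<le> len (covered y' k)"
    using T T' by (simp add: len_units card_mono)
  then show "real_of_int \<lfloor>len (covered y k)\<rfloor> \<le> real_of_int \<lfloor>len (covered y' k)\<rfloor>"
    using floor_mono by simp
qed

lemma revenue_nonneg: "0 \<le> revenue y"
  unfolding revenue_def len_def
  by (intro sum_nonneg mult_nonneg_nonneg) (use value_pos in \<open>auto intro: less_imp_le\<close>)

text \<open>A positive quota is the minimum of a cardinality and an integer, hence a natural number
  not exceeding the number of free units. This turns \<open>first_units\<close> into the
  combinatorial \<open>first_elems\<close>.\<close>

lemma quota_nat:
  assumes "unit_schedule y" "valid_bid (b j)" "0 < quota b y j"
  obtains k T where "quota b y j = real k" "finite T" "covered y (\<kappa> j) = units T"
    "free b y j = units {arrival (b j)..<departure (b j)} - units T"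
    "len (free b y j) = card ({arrival (b j)..<departure (b j)} - T)"
    "k \<le> card ({arrival (b j)..<departure (b j)} - T)"
    "first_units (quota b y j) (free b y j) = units (first_elems k ({arrival (b j)..<departure (b j)} - T))"
proof -
  obtain T where T: "finite T" "covered y (\<kappa> j) = units T"
    "free b y j = units {arrival (b j)..<departure (b j)} - units T"
    "len (free b y j) = card ({arrival (b j)..<departure (b j)} - T)"
    by (metis free_units assms(1,2))
  obtain z :: int where z: "quota b y j = min (len (free b y j)) z"
    unfolding quota_def by blast
  obtain k where k: "quota b y j = real k"
  proof (cases "z \<le> len (free b y j)")
    case True
    with z assms(3) show thesis by (intro that[of "nat z"]) auto
  next
    case False
    with z T(4) show thesis by (intro that) auto
  qed
  have "k \<le> card ({arrival (b j)..<departure (b j)} - T)"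
    using z k T(4) by linarith
  then show thesis
    using that[OF k T] by (simp add: first_units_diff T(3) k)
qed

lemma len_first_units:
  assumes "unit_schedule y" "valid_bid (b j)" "0 < quota b y j"
  shows "len (first_units (quota b y j) (free b y j)) = quota b y j"
proof (rule quota_nat[OF assms])
  fix k T
  assume k: "quota b y j = real k" "k \<le> card ({arrival (b j)..<departure (b j)} - T)"
    "first_units (quota b y j) (free b y j) = units (first_elems k ({arrival (b j)..<departure (b j)} - T))"
  have "finite (first_elems k ({arrival (b j)..<departure (b j)} - T))"
    by (rule finite_subset[OF first_elems_subset]) simp
  then show ?thesis
    using card_first_elems[OF _ k(2)] by (simp only: k(3) len_units) (simp add: k(1))
qed

lemma unit_schedule_serve:
  assumes "unit_schedule y" "valid_bid (b j)"
  shows "unit_schedule (serve b y j)"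
proof (cases "0 < quota b y j")
  case True
  show ?thesis
  proof (rule quota_nat[OF assms True])
    fix k T
    assume k: "first_units (quota b y j) (free b y j) =
        units (first_elems k ({arrival (b j)..<departure (b j)} - T))"
    have "finite (first_elems k ({arrival (b j)..<departure (b j)} - T))"
      by (rule finite_subset[OF first_elems_subset]) simp
    with assms(1) k show ?thesis
      unfolding unit_schedule_def serve_def by (auto simp: fun_upd_def)
  qed
qed (use assms in \<open>simp add: serve_def\<close>)

lemma serve_ge: "y j = {} \<Longrightarrow> y \<le> serve b y j"
  by (auto simp: serve_def le_fun_def)

lemma serve_other: "l \<noteq> j \<Longrightarrow> serve b y j l = y l"
  by (auto simp: serve_def)

lemma pass_unit_schedule:
  assumes "unit_schedule y" "\<And>j. j \<in> set L \<Longrightarrow> valid_bid (b j)" "pass b y L = Some y'"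
  shows "unit_schedule y'"
  using assms by (induction L arbitrary: y) (auto split: if_splits intro: unit_schedule_serve)

text \<open>\<open>serve\<close> overwrites the entry of the served user, so a run enlarges the
  schedule only if the listed users start out empty; distinctness keeps the entries of the tail
  empty along the way.\<close>

lemma pass_ge:
  assumes "pass b y L = Some y'" "\<And>j. j \<in> set L \<Longrightarrow> y j = {}" "distinct L"
  shows "y \<le> y'"
  using assms
proof (induction L arbitrary: y)
  case (Cons j L)
  have "serve b y j l = {}" if "l \<in> set L" for l
    using Cons.prems(2)[of l] Cons.prems(3) that serve_other[of l j b y] by auto
  with Cons.prems have "serve b y j \<le> y'"
    by (intro Cons.IH) (auto split: if_splits)
  with Cons.prems serve_ge[of y j b] show ?case
    by (meson list.set_intros(1) order_trans)
qed simp

lemma pass_other: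
  assumes "pass b y L = Some y'" "l \<notin> set L"
  shows "y' l = y l"
  using assms by (induction L arbitrary: y) (auto split: if_splits simp: serve_other)

text \<open>Applied to a list without user \<open>i\<close>, this shows that the run of his
  competitors is the same for both of his reports.\<close>

lemma pass_cong:
  assumes "\<And>j. j \<in> set L \<Longrightarrow> b j = b' j"
  shows "pass b y L = pass b' y L"
  using assms
proof (induction L arbitrary: y)
  case (Cons j L)
  have "b j = b' j" using Cons.prems by simp
  then have "free b y j = free b' y j" "quota b y j = quota b' y j"
    by (simp_all add: free_def quota_def)
  then have "blocked b y j = blocked b' y j" "serve b y j = serve b' y j"
    by (simp_all add: blocked_def serve_def)
  with Cons show ?case by simp
qed simp

subsection \<open>Priority lists\<close>

lemma prec_irrefl: "\<not> prec b i i"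
  by (simp add: prec_def)

lemma prec_trans: "prec b i j \<Longrightarrow> prec b j k \<Longrightarrow> prec b i k"
  by (auto simp: prec_def)

lemma prec_total: "i \<noteq> j \<Longrightarrow> prec b i j \<or> prec b j i"
  by (auto simp: prec_def)

abbreviation descending :: "bids \<Rightarrow> nat list \<Rightarrow> bool" where
  "descending b \<equiv> sorted_wrt (\<lambda>j i. prec b i j)"

text \<open>This places user \<open>i\<close> in a priority list that was sorted without knowledge
  of his bid.\<close>

lemma descending_insert:
  assumes "descending b L" "i \<notin> set L"
  shows "descending b (takeWhile (prec b i) L @ i # dropWhile (prec b i) L)"
  using assms
proof (induction L)
  case (Cons j L)
  show ?case
  proof (cases "prec b i j")
    case True
    have "\<And>k. k \<in> set (takeWhile (prec b i) L) \<or> k \<in> set (dropWhile (prec b i) L) \<Longrightarrow> k \<in> set L"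
      by (auto dest: set_takeWhileD set_dropWhileD)
    with Cons True show ?thesis by auto
  next
    case False
    with Cons.prems prec_total have "prec b j i" by auto
    with Cons.prems False prec_trans show ?thesis by auto
  qed
qed simp

lemma descending_exists:
  assumes "finite A"
  obtains L where "set L = A" "distinct L" "descending b L"
  using assms
proof (induction A arbitrary: thesis)
  case empty
  show ?case by (rule empty[of "[]"]) auto
next
  case (insert i A)
  obtain L where L: "set L = A" "distinct L" "descending b L"
    by (rule insert.IH)
  let ?L = "takeWhile (prec b i) L @ i # dropWhile (prec b i) L"
  have S: "set (takeWhile (prec b i) L) \<union> set (dropWhile (prec b i) L) = A"
    by (metis L(1) set_append takeWhile_dropWhile_id)
  then have "set ?L = insert i A" by auto
  moreover have "set (takeWhile (prec b i) L) \<inter> set (dropWhile (prec b i) L) = {}"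
    by (metis L(2) distinct_append takeWhile_dropWhile_id)
  then have "distinct ?L"
    using L(2) S insert.hyps by auto
  ultimately show ?case
    using descending_insert[OF L(3)] L(1) insert.hyps by (intro insert.prems[of ?L]) auto
qed

lemma prec_max_eq:
  assumes "j \<in> A" "\<And>i. i \<in> A \<Longrightarrow> i \<noteq> j \<Longrightarrow> prec b i j"
  shows "prec_max b A = j"
  unfolding prec_max_def
proof (rule the_equality)
  show "k = j" if "k \<in> A \<and> (\<forall>i\<in>A. i \<noteq> k \<longrightarrow> prec b i k)" for k
    using that assms by (metis prec_trans prec_irrefl)
qed (use assms in blast)

subsection \<open>ApproxMCS as a list recursion\<close>

fun greedy :: "bids \<Rightarrow> schedule \<Rightarrow> nat list \<Rightarrow> nat list \<Rightarrow> schedule \<times> nat list" where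
  "greedy b y W [] = (y, W)"
| "greedy b y W (j # L) =
     (let W' = (if quota b y j > 0 then W @ [j] else W)
      in if blocked b y j then (serve b y j, W') else greedy b (serve b y j) W' L)"

lemma window_covered_iff:
  assumes "unit_schedule y" "valid_bid (b j)"
  shows "window (b j) \<sqsubseteq> covered y (\<kappa> j) \<longleftrightarrow> len (free b y j) = 0"
  using covered_units[OF assms(1), of "\<kappa> j"] window_units[OF assms(2)]
  unfolding free_def by (metis finite_atLeastLessThan_int units_ess_subset_iff_len)

lemma quota_le_len: "quota b y j \<le> len (free b y j)"
  by (simp add: quota_def)

text \<open>The first \<open>k\<close> elements of a set with \<open>k\<close> elements are all of
  it. Hence a served user who does not stop the loop has his window covered and leaves the set
  \<open>D\<close>, as the step to the tail of the list requires.\<close>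

lemma serve_exhausts:
  assumes "unit_schedule y" "valid_bid (b j)" "j \<in> {1..n}" "y j = {}"
    and "0 < quota b y j" "quota b y j = len (free b y j)"
  shows "len (free b (serve b y j) j) = 0"
proof (rule quota_nat[OF assms(1,2,5)])
  fix k T
  let ?F = "{arrival (b j)..<departure (b j)} - T"
  assume k: "quota b y j = real k" "len (free b y j) = card ?F"
    "first_units (quota b y j) (free b y j) = units (first_elems k ?F)"
    "free b y j = units {arrival (b j)..<departure (b j)} - units T"
  have "k = card ?F"
    using k(1,2) assms(6) by simp
  then have "card (first_elems k ?F) = card ?F"
    by (simp add: card_first_elems)
  then have "first_elems k ?F = ?F"
    by (intro card_subset_eq first_elems_subset) auto
  then have "free b y j \<subseteq> serve b y j j"
    using assms(5) k(3,4) by (auto simp: serve_def units_def)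
  moreover have "serve b y j j \<subseteq> covered (serve b y j) (\<kappa> j)"
    using assms(3) by (auto simp: covered_def)
  moreover have "free b (serve b y j) j \<subseteq> free b y j"
    by (intro free_mono serve_ge assms)
  ultimately have "free b (serve b y j) j = {}"
    unfolding free_def by blast
  then show ?thesis
    by (simp add: len_def)
qed

text \<open>The loop works on the listed users whose windows are not yet covered, while
  \<open>greedy\<close> visits every user. The extra visits have no effect: a covered user has quota
  at most 0 and is not \<open>blocked\<close>. Coverage is never lost, because the schedule only
  grows.\<close>

lemma approx_while_eq_greedy:
  assumes "valid_bids n b" "descending b L" "distinct L" "set L \<subseteq> {1..n}"
    and "unit_schedule y" "\<And>l. l \<in> set L \<Longrightarrow> y l = {}"
  shows "(case while (\<lambda>(D, W, y, halt). \<not> halt \<and> D \<noteq> {}) (approx_step b)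
            ({l \<in> set L. \<not> window (b l) \<sqsubseteq> covered y (\<kappa> l)}, W, y, False)
          of (D, W, y, halt) \<Rightarrow> (y, W)) = greedy b y W L"
  using assms(2-)
proof (induction L arbitrary: y W)
  case Nil
  show ?case by (simp add: while_unfold)
next
  case (Cons j L)
  let ?D = "{l \<in> set (j # L). \<not> window (b l) \<sqsubseteq> covered y (\<kappa> l)}"
  have valid: "valid_bid (b l)" if "l \<in> set (j # L)" for l
    using that Cons.prems(3) assms(1) by (intro valid_bidsD) auto
  have j: "j \<in> {1..n}" "y j = {}" "valid_bid (b j)"
    using Cons.prems valid by auto
  show ?case
  proof (cases "len (free b y j) = 0")
    case True
    then have "serve b y j = y" "\<not> blocked b y j" "\<not> 0 < quota b y j"
      using quota_le_len[of b y j] by (auto simp: serve_def blocked_def)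
    moreover have "?D = {l \<in> set L. \<not> window (b l) \<sqsubseteq> covered y (\<kappa> l)}"
      using True window_covered_iff[where b = b and j = j, OF Cons.prems(4) j(3)] by auto
    ultimately show ?thesis
      using Cons.IH[of y W] Cons.prems by simp
  next
    case False
    then have pos: "0 < len (free b y j)"
      by (simp add: len_def zero_less_measure_iff)
    have "j \<in> ?D"
      using False window_covered_iff[where b = b and j = j, OF Cons.prems(4) j(3)] by simp
    then have D: "?D \<noteq> {}" "prec_max b ?D = j"
      using Cons.prems(1) by (auto intro!: prec_max_eq)
    show ?thesis
    proof (cases "0 < quota b y j")
      case q: True
      have step: "approx_step b (?D, W, y, False) =
          ({l \<in> ?D. \<not> window (b l) \<sqsubseteq> covered (serve b y j) (\<kappa> l)}, W @ [j], serve b y j, blocked b y j)"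
        using q pos unfolding approx_step_def prod.case Let_def D(2) serve_def blocked_def by simp
      show ?thesis
      proof (cases "blocked b y j")
        case True
        then show ?thesis
          using q D(1) step by (subst while_unfold, subst while_unfold) simp
      next
        case nb: False
        have y': "unit_schedule (serve b y j)"
          using Cons.prems(4) j(3) by (rule unit_schedule_serve)
        have "window (b j) \<sqsubseteq> covered (serve b y j) (\<kappa> j)"
          unfolding window_covered_iff[where b = b and j = j, OF y' j(3)]
          using nb pos quota_le_len[of b y j]
          by (intro serve_exhausts Cons.prems(4) j q) (simp add: blocked_def)
        moreover have "window (b l) \<sqsubseteq> covered (serve b y j) (\<kappa> l)"
          if "l \<in> set L" "window (b l) \<sqsubseteq> covered y (\<kappa> l)" for l
        proof -
          have l: "valid_bid (b l)" using valid that by simp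
          have "len (free b (serve b y j) l) \<le> len (free b y l)"
            by (intro len_free_mono serve_ge j Cons.prems(4) y' l)
          with that(2) window_covered_iff[where b = b and j = l, OF _ l] Cons.prems(4) y'
          show ?thesis
            by (simp add: len_def antisym)
        qed
        ultimately have "{l \<in> ?D. \<not> window (b l) \<sqsubseteq> covered (serve b y j) (\<kappa> l)} =
            {l \<in> set L. \<not> window (b l) \<sqsubseteq> covered (serve b y j) (\<kappa> l)}"
          by auto
        moreover have "serve b y j l = {}" if "l \<in> set L" for l
          using Cons.prems(2,5) that serve_other[of l j b y] by auto
        ultimately show ?thesis
          using q D(1) step nb Cons.IH[of "serve b y j" "W @ [j]"] y' Cons.prems(1-3)
          by (subst while_unfold) simp
      qed
    next
      case q: False
      \<comment> \<open>With free time left but no positive quota only the halt flag changes, so the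
        second unfolding ends the loop.\<close>
      then have "approx_step b (?D, W, y, False) = (?D, W, y, True)" "blocked b y j" "serve b y j = y"
        using pos unfolding approx_step_def prod.case Let_def D(2) by (auto simp: blocked_def serve_def)
      then show ?thesis
        using D(1) q by (subst while_unfold, subst while_unfold) simp
    qed
  qed
qed

lemma approx_mcs_eq_greedy:
  assumes "valid_bids n b" "descending b L" "distinct L" "set L = {1..n}"
  shows "approx_mcs b = greedy b (\<lambda>_. {}) [] L"
proof -
  have "\<not> window (b l) \<sqsubseteq> covered (\<lambda>_. {}) (\<kappa> l)" if "l \<in> {1..n}" for l
  proof -
    have l: "valid_bid (b l)"
      using assms(1) that by (rule valid_bidsD)
    then have "arrival (b l) \<in> {arrival (b l)..<departure (b l)}"
      by (simp add: valid_bid_def)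
    then show ?thesis
      using ess_subset_unitsD[of "{arrival (b l)..<departure (b l)}" "{}"] by (auto simp: window_units[OF l] covered_def)
  qed
  then have "{l \<in> set L. \<not> window (b l) \<sqsubseteq> covered (\<lambda>_. {}) (\<kappa> l)} = {1..n}"
    using assms(4) by auto
  with approx_while_eq_greedy[OF assms(1-3), of "\<lambda>_. {}" "[]"] assms(4) unit_schedule_empty
  show ?thesis
    by (simp add: approx_mcs_def)
qed

lemma snd_greedy: "\<exists>V. snd (greedy b y W L) = W @ V \<and> set V \<subseteq> set L"
proof (induction L arbitrary: y W)
  case (Cons j L)
  let ?U = "if quota b y j > 0 then [j] else []"
  obtain V where "snd (greedy b (serve b y j) (W @ ?U) L) = (W @ ?U) @ V" "set V \<subseteq> set L"
    using Cons.IH by blast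
  moreover have "(if quota b y j > 0 then W @ [j] else W) = W @ ?U"
    by simp
  ultimately show ?case
    by (intro exI[of _ "if blocked b y j then ?U else ?U @ V"]) (simp only: greedy.simps Let_def, auto)
qed simp

lemma fst_greedy_other: "l \<notin> set L \<Longrightarrow> fst (greedy b y W L) l = y l"
  by (induction L arbitrary: y W) (auto simp: Let_def serve_other)

text \<open>The schedule rebuilt from \<open>takeWhile\<close> is the initial one of CalPayment.\<close>

lemma greedy_at:
  fixes b :: bids
  assumes "distinct (A @ i # B)" "\<And>l. y l \<noteq> {} \<Longrightarrow> l \<in> set W" "set W \<inter> set (A @ i # B) = {}"
  defines "r \<equiv> greedy b y W (A @ i # B)"
  shows "case pass b y A of
      None \<Rightarrow> i \<notin> set (snd r) \<and> fst r i = {}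
    | Some t \<Rightarrow>
        if quota b t i > 0 then
          i \<in> set (snd r) \<and> fst r i = first_units (quota b t i) (free b t i) \<and>
          (\<lambda>l. if l \<in> set (takeWhile (\<lambda>l. l \<noteq> i) (snd r)) then fst r l else {}) = t
        else i \<notin> set (snd r) \<and> fst r i = {}"
  using assms(1-3) unfolding r_def
proof (induction A arbitrary: y W)
  case Nil
  let ?W = "if quota b y i > 0 then W @ [i] else W"
  have yi: "y i = {}" using Nil by auto
  obtain V where V: "snd (greedy b y W (i # B)) = ?W @ V" "set V \<subseteq> set B"
  proof (cases "blocked b y i")
    case True
    then show ?thesis
      by (intro that[of "[]"]) (auto simp: Let_def)
  next
    case False
    then show ?thesis
      using snd_greedy[of b "serve b y i" ?W B] that by (auto simp: Let_def)
  qed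
  have F: "fst (greedy b y W (i # B)) l = serve b y i l" if "l \<notin> set B" for l
    using that by (simp add: Let_def fst_greedy_other)
  show ?case
  proof (cases "quota b y i > 0")
    case True
    have W: "takeWhile (\<lambda>l. l \<noteq> i) (snd (greedy b y W (i # B))) = W"
      using V Nil.prems(3) True by (auto simp: takeWhile_append)
    \<comment> \<open>Members of \<open>W\<close> are not served again, and outside \<open>W\<close>
      the schedule \<open>y\<close> is still empty.\<close>
    have "(\<lambda>l. if l \<in> set W then fst (greedy b y W (i # B)) l else {}) = y"
    proof
      fix l
      show "(if l \<in> set W then fst (greedy b y W (i # B)) l else {}) = y l"
      proof (cases "l \<in> set W")
        case True
        then have "l \<notin> set B" "l \<noteq> i"
          using Nil.prems(3) by auto
        with True F[of l] serve_other[of l i b y] show ?thesis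
          by (simp del: greedy.simps)
      qed (use Nil.prems(2)[of l] in auto)
    qed
    then show ?thesis
      using True V F[of i] Nil.prems(1) W unfolding append_Nil by (simp add: serve_def del: greedy.simps)
  next
    case False
    then show ?thesis
      using V F[of i] Nil.prems yi by (auto simp: serve_def)
  qed
next
  case (Cons j A)
  let ?W = "if quota b y j > 0 then W @ [j] else W"
  show ?case
  proof (cases "blocked b y j")
    case True
    have "i \<noteq> j" "i \<notin> set W" "y i = {}"
      using Cons.prems by auto
    with True show ?thesis
      by (simp add: Let_def serve_other)
  next
    case False
    have W: "l \<in> set ?W" if "serve b y j l \<noteq> {}" for l
      using that Cons.prems(2)[of l] by (auto simp: serve_def split: if_splits)
    have disj: "set ?W \<inter> set (A @ i # B) = {}" "distinct (A @ i # B)"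
      using Cons.prems by auto
    have step: "greedy b y W ((j # A) @ i # B) = greedy b (serve b y j) ?W (A @ i # B)"
      "pass b y (j # A) = pass b (serve b y j) A"
      using False by (simp_all add: Let_def)
    show ?thesis
      unfolding step using disj(2) W disj(1) by (rule Cons.IH)
  qed
qed

end

lemma interval_integral_to_infinity_zero:
  fixes f :: "real \<Rightarrow> real"
  assumes "\<And>v. c < ereal v \<Longrightarrow> f v = 0"
  shows "(LBINT v = c..\<infinity>. f v) = 0"
proof -
  have "(LBINT v = c..\<infinity>. f v) = (LBINT v = c..\<infinity>. 0)"
    by (rule interval_integral_cong) (use assms in \<open>auto simp: einterval_iff min_def\<close>)
  then show ?thesis by simp
qed

context mcs
begin

subsection \<open>The allocation as a function of the declared cost\<close>

text \<open>The quota of \<open>i\<close> with his cost replaced by \<open>v\<close>. The cut-off at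
  0 is needed because the budget term becomes negative once the budget is exceeded, whereas the user
  then simply receives nothing.\<close>

definition offer :: "bids \<Rightarrow> nat \<Rightarrow> real \<Rightarrow> schedule \<Rightarrow> real" where
  "offer b i v y = max 0 (min (len (free b y i)) (of_int \<lfloor>G / (2 * v) - revenue y / \<mu> i\<rfloor>))"

text \<open>This is \<open>prec b i j\<close> with the cost of \<open>i\<close> as a free parameter,
  so that it can vary while the bids stay fixed.\<close>

definition outranked :: "bids \<Rightarrow> nat \<Rightarrow> real \<Rightarrow> nat \<Rightarrow> bool" where
  "outranked b i v j \<longleftrightarrow>
     \<mu> i / v < \<mu> j / cost (b j) \<or> \<mu> i / v = \<mu> j / cost (b j) \<and> j > i"

text \<open>The curve \<open>x\<close> of the overview, generalized to a run that has already
  reached \<open>y\<close> and still has the competitors \<open>L\<close> ahead. The generality is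
  what an induction along the loop of CalPayment needs.\<close>

definition share :: "bids \<Rightarrow> nat \<Rightarrow> schedule \<Rightarrow> nat list \<Rightarrow> real \<Rightarrow> real" where
  "share b i y L v =
     (case pass b y (takeWhile (outranked b i v) L) of None \<Rightarrow> 0 | Some t \<Rightarrow> offer b i v t)"

lemma prec_eq_outranked: "prec b i = outranked b i (cost (b i))"
  by (simp add: fun_eq_iff prec_def outranked_def)

lemma outranked_mono:
  assumes "0 < v" "v \<le> v'" "i \<in> {1..n}" "outranked b i v j"
  shows "outranked b i v' j"
proof -
  have "\<mu> i / v' \<le> \<mu> i / v"
    using assms value_positive[of i] by (intro divide_left_mono) auto
  then show ?thesis
    using assms(4) by (auto simp: outranked_def)
qed

lemma takeWhile_mono_prefix:
  assumes "\<And>x. P x \<Longrightarrow> Q x"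
  obtains R where "takeWhile Q L = takeWhile P L @ R" "set R \<subseteq> set L"
proof (induction L arbitrary: thesis)
  case (Cons x L)
  obtain R where R: "takeWhile Q L = takeWhile P L @ R" "set R \<subseteq> set L"
    by (rule Cons.IH)
  show ?case
  proof (cases "P x")
    case True
    with R assms show ?thesis by (intro Cons.prems[of R]) auto
  next
    case False
    then show ?thesis
      by (intro Cons.prems[of "takeWhile Q (x # L)"]) (auto dest: set_takeWhileD split: if_splits)
  qed
qed simp

lemma offer_nonneg: "0 \<le> offer b i v y"
  by (simp add: offer_def)

text \<open>Both terms of the minimum shrink: a larger schedule leaves less free time, and a higher
  cost together with more revenue lowers the budget term.\<close>

lemma offer_antimono:
  assumes "0 < v" "v \<le> v'" "y \<le> y'" "unit_schedule y" "unit_schedule y'" "valid_bid (b i)" "i \<in> {1..n}"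
  shows "offer b i v' y' \<le> offer b i v y"
proof -
  have "G / (2 * v') \<le> G / (2 * v)"
    using assms budget_pos by (intro divide_left_mono) auto
  moreover have "revenue y / \<mu> i \<le> revenue y' / \<mu> i"
    using assms value_positive[of i] revenue_mono by (intro divide_right_mono) auto
  ultimately have "\<lfloor>G / (2 * v') - revenue y' / \<mu> i\<rfloor> \<le> \<lfloor>G / (2 * v) - revenue y / \<mu> i\<rfloor>"
    by (intro floor_mono) linarith
  moreover have "len (free b y' i) \<le> len (free b y i)"
    using assms by (intro len_free_mono)
  ultimately show ?thesis
    unfolding offer_def by (intro max.mono min.mono) auto
qed

lemma share_nonneg: "0 \<le> share b i y L v"
  by (simp add: share_def offer_nonneg split: option.split)

end

text \<open>A greedy run starting from \<open>y\<close> over the list \<open>L\<close> of pending competitors of user \<open>i\<close>.\<close>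

locale pending = mcs +
  fixes b :: bids and i :: nat and y :: schedule and L :: "nat list"
  assumes valid: "valid_bids n b"
    and user: "i \<in> {1..n}"
    and competitors: "set L \<subseteq> {1..n}" "i \<notin> set L" "distinct L"
    and unit_schedule: "unit_schedule y"
    and vacant: "\<And>l. l \<in> set L \<Longrightarrow> y l = {}"
begin

lemma valid_bid: "j \<in> {1..n} \<Longrightarrow> valid_bid (b j)"
  using valid by (rule valid_bidsD)

lemma pass_prefix_ge:
  assumes "pass b y A = Some t" "L = A @ B"
  shows "y \<le> t" "unit_schedule t" "\<And>l. l \<in> set B \<Longrightarrow> t l = {}"
proof -
  show "y \<le> t"
    using assms competitors vacant by (intro pass_ge[of b y A t]) auto
  show "unit_schedule t"
    using assms competitors valid_bid unit_schedule by (intro pass_unit_schedule[of y A b t]) auto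
  show "t l = {}" if "l \<in> set B" for l
  proof -
    have "l \<notin> set A"
      using that assms(2) competitors(3) by auto
    then show ?thesis
      using that assms vacant pass_other[of b y A t l] by simp
  qed
qed

text \<open>A higher declared cost lets a longer prefix of the same list go first. If the longer run
  is not stopped, neither is the shorter one, and the remaining users only add to its
  schedule.\<close>

lemma pass_outranked_mono:
  assumes "0 < v" "v \<le> v'" "pass b y (takeWhile (outranked b i v') L) = Some t'"
  obtains t where "pass b y (takeWhile (outranked b i v) L) = Some t" "t \<le> t'"
    "unit_schedule t" "unit_schedule t'"
proof -
  obtain R where R: "takeWhile (outranked b i v') L = takeWhile (outranked b i v) L @ R"
    using takeWhile_mono_prefix[of "outranked b i v" "outranked b i v'" L]
      outranked_mono[OF assms(1,2) user] by metis
  with assms(3) obtain t where t: "pass b y (takeWhile (outranked b i v) L) = Some t" "pass b t R = Some t'"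
    by (auto simp: pass_append bind_eq_Some_conv)
  have L: "L = takeWhile (outranked b i v) L @ (R @ dropWhile (outranked b i v') L)"
    using takeWhile_dropWhile_id[of "outranked b i v'" L] R by simp
  note t_props = pass_prefix_ge[OF t(1) L]
  have "t \<le> t'"
    using t(2)
  proof (rule pass_ge)
    show "t j = {}" if "j \<in> set R" for j
      using that t_props(3) by simp
    show "distinct R"
      using competitors(3) L by (metis distinct_append)
  qed
  moreover have "unit_schedule t'"
    using pass_prefix_ge(2)[OF assms(3) takeWhile_dropWhile_id[symmetric]] .
  ultimately show thesis
    using that t(1) t_props(2) by blast
qed

lemma share_antimono:
  assumes "0 < v" "v \<le> v'"
  shows "share b i y L v' \<le> share b i y L v"
proof (cases "pass b y (takeWhile (outranked b i v') L)")
  case None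
  then show ?thesis
    using share_nonneg[of b i y L v] by (simp add: share_def)
next
  case (Some t')
  then obtain t where t: "pass b y (takeWhile (outranked b i v) L) = Some t" "t \<le> t'"
      "unit_schedule t" "unit_schedule t'"
    using pass_outranked_mono assms by blast
  then have "offer b i v' t' \<le> offer b i v t"
    using assms valid_bid user by (intro offer_antimono)
  with Some t show ?thesis
    by (simp add: share_def)
qed

lemma share_le_offer:
  assumes "0 < v"
  shows "share b i y L v \<le> offer b i v y"
proof (cases "pass b y (takeWhile (outranked b i v) L)")
  case None
  then show ?thesis
    by (simp add: share_def offer_nonneg)
next
  case (Some t)
  note t = pass_prefix_ge[OF Some takeWhile_dropWhile_id[symmetric]]
  have "offer b i v t \<le> offer b i v y"
    using assms t(1,2) unit_schedule valid_bid user by (intro offer_antimono) auto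
  with Some show ?thesis
    by (simp add: share_def)
qed

lemma share_eq_0_if_offer: "0 < v \<Longrightarrow> offer b i v y = 0 \<Longrightarrow> share b i y L v = 0"
  using share_le_offer[of v] share_nonneg[of b i y L v] by simp

text \<open>Monotonicity gives measurability. For \<open>v > G\<close> the quotient
  \<open>G / (2 * v)\<close> is below 1, so its budget term has no positive integer part and the
  share vanishes; what remains is bounded by the free length on \<open>{c..G}\<close>.\<close>

lemma share_integrable:
  assumes "0 < c"
  shows "set_integrable lborel {c<..} (share b i y L)"
proof -
  let ?f = "share b i y L"
  have "mono_on {c<..} (\<lambda>v. - ?f v)"
    using assms by (intro mono_onI) (auto intro!: share_antimono)
  then have "(\<lambda>v. - (- ?f v)) \<in> borel_measurable (restrict_space borel {c<..})"
    by (intro borel_measurable_uminus borel_measurable_mono_on_fnc)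
  then have "?f \<in> borel_measurable (restrict_space borel {c<..})"
    by simp
  then have meas: "(\<lambda>v. indicator {c<..} v *\<^sub>R ?f v) \<in> borel_measurable borel"
    by (subst (asm) borel_measurable_restrict_space_iff) auto
  have bound: "norm (indicator {c<..} v *\<^sub>R ?f v) \<le> norm (len (free b y i) * indicator {c..G} v)" for v
  proof (cases "c < v")
    case True
    have "?f v \<le> offer b i v y"
      using True assms by (intro share_le_offer) simp
    also have "\<dots> \<le> len (free b y i) * indicator {c..G} v"
    proof (cases "v \<le> G")
      case True
      with \<open>c < v\<close> show ?thesis
        by (simp add: offer_def len_def)
    next
      case False
      then have "G / (2 * v) < 1"
        using budget_pos by (simp add: divide_less_eq)
      moreover have "0 \<le> revenue y / \<mu> i"
        using revenue_nonneg[of y] value_positive[OF user] by simp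
      ultimately have "\<lfloor>G / (2 * v) - revenue y / \<mu> i\<rfloor> < 1"
        unfolding floor_less_one by linarith
      then have "real_of_int \<lfloor>G / (2 * v) - revenue y / \<mu> i\<rfloor> \<le> 0" by linarith
      then have "offer b i v y = 0"
        unfolding offer_def by linarith
      then show ?thesis
        using False by simp
    qed
    finally show ?thesis
      using True share_nonneg[of b i y L v] by (simp add: len_def)
  qed (simp add: len_def)
  have "integrable lborel (\<lambda>v. len (free b y i) * indicator {c..G} v :: real)"
    by (intro integrable_mult_right) (auto simp: integrable_indicator_iff emeasure_lborel_Icc_eq)
  then show ?thesis
    unfolding set_integrable_def
  proof (rule Bochner_Integration.integrable_bound)
    show "(\<lambda>v. indicator {c<..} v *\<^sub>R ?f v) \<in> borel_measurable lborel"
      using meas by (simp only: measurable_lborel2)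
  qed (intro AE_I2 bound)
qed

lemma share_integral_split:
  assumes "0 < c" "ereal c \<le> d"
  shows "(LBINT v = ereal c..\<infinity>. share b i y L v) =
    (LBINT v = ereal c..d. share b i y L v) + (LBINT v = d..\<infinity>. share b i y L v)"
proof -
  have "einterval (ereal c) \<infinity> = {c<..}"
    by (auto simp: einterval_iff)
  with assms share_integrable[OF assms(1)] show ?thesis
    by (intro interval_integral_sum[symmetric])
       (simp add: interval_lebesgue_integrable_def min_def max_def)
qed

text \<open>The cost at which \<open>G / (2 * v)\<close> equals \<open>revenue y / \<mu> i\<close>,
  the bound called \<open>\<gamma>\<close> in CalPayment. Below it the integrand of CalPayment needs
  no cut-off and equals \<open>offer\<close>; above it the offer is 0.\<close>

definition "budget_limit = (if revenue y = 0 then \<infinity> else ereal (\<mu> i * G / (2 * revenue y)))"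

lemma offer_beyond_budget:
  assumes "0 < v" "budget_limit < ereal v"
  shows "offer b i v y = 0"
proof -
  have R: "revenue y > 0" "\<mu> i * G / (2 * revenue y) < v"
    using assms revenue_nonneg[of y] by (auto simp: budget_limit_def split: if_splits)
  then have "G / (2 * v) < revenue y / \<mu> i"
    using assms value_positive[OF user] by (simp add: field_simps)
  then have "real_of_int \<lfloor>G / (2 * v) - revenue y / \<mu> i\<rfloor> < 0"
    by simp
  then show ?thesis
    unfolding offer_def by linarith
qed

lemma offer_within_budget:
  assumes "0 < v" "ereal v < budget_limit"
  shows "offer b i v y = min (len (free b y i)) (of_int \<lfloor>G / (2 * v) - revenue y / \<mu> i\<rfloor>)"
proof -
  have "revenue y / \<mu> i \<le> G / (2 * v)"
  proof (cases "revenue y = 0")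
    case True
    then show ?thesis using assms budget_pos by simp
  next
    case False
    then have R: "revenue y > 0" "v < \<mu> i * G / (2 * revenue y)"
      using assms revenue_nonneg[of y] by (auto simp: budget_limit_def)
    then show ?thesis
      using assms value_positive[OF user] by (simp add: field_simps)
  qed
  then have "0 \<le> \<lfloor>G / (2 * v) - revenue y / \<mu> i\<rfloor>"
    by simp
  then show ?thesis
    by (simp add: offer_def len_def)
qed

end

context mcs
begin

subsection \<open>CalPayment computes an integral\<close>

lemma prec_max_hd:
  assumes "descending b (j # L)"
  shows "prec_max b (set (j # L)) = j"
  using assms by (intro prec_max_eq) auto

text \<open>The declared cost at which user \<open>i\<close> is tied with user \<open>j\<close>.\<close>

abbreviation critical :: "bids \<Rightarrow> nat \<Rightarrow> nat \<Rightarrow> real" where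
  "critical b i j \<equiv> \<mu> i / \<mu> j * cost (b j)"

text \<open>The tie cost itself, where the index rule decides, can be left out: the integrals below
  range over open intervals.\<close>

lemma outranked_iff_critical:
  assumes "valid_bid (b j)" "i \<in> {1..n}" "j \<in> {1..n}" "0 < v"
  shows "critical b i j < v \<Longrightarrow> outranked b i v j"
    and "v < critical b i j \<Longrightarrow> \<not> outranked b i v j"
  using assms value_positive[of i] value_positive[of j]
  by (auto simp: outranked_def valid_bid_def field_simps)

text \<open>Decreasing priority means increasing tie cost, so along the list these values are the
  successive breakpoints of the integration in CalPayment.\<close>

lemma critical_mono:
  assumes "valid_bid (b j)" "valid_bid (b k)" "i \<in> {1..n}" "j \<in> {1..n}" "k \<in> {1..n}" "prec b k j"
  shows "critical b i j \<le> critical b i k"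
proof -
  have "\<mu> k / cost (b k) \<le> \<mu> j / cost (b j)"
    using assms(6) by (auto simp: prec_def)
  then have "cost (b j) / \<mu> j \<le> cost (b k) / \<mu> k"
    using assms value_positive[of j] value_positive[of k] by (simp add: valid_bid_def field_simps)
  then have "\<mu> i * (cost (b j) / \<mu> j) \<le> \<mu> i * (cost (b k) / \<mu> k)"
    using assms value_positive[of i] by (intro mult_left_mono) auto
  then show ?thesis
    by simp
qed

definition pay_result :: "bids \<Rightarrow> nat \<Rightarrow> schedule \<times> nat set \<times> real \<times> nat \<times> int \<times> bool \<Rightarrow> real" where
  "pay_result b i s =
     (case while (\<lambda>(t, S, p, k, \<theta>, halt). \<not> halt \<and> \<theta> \<ge> 0) (pay_step b i) s
      of (t, S, p, k, \<theta>, halt) \<Rightarrow> p)"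

lemma pay_result_halt [simp]:
  "pay_result b i (t, S, p, k, \<theta>, True) = p"
  "\<theta> < 0 \<Longrightarrow> pay_result b i (t, S, p, k, \<theta>, halt) = p"
  by (simp_all add: pay_result_def while_unfold)

lemma pay_result_step:
  "0 \<le> \<theta> \<Longrightarrow> pay_result b i (t, S, p, k, \<theta>, False) = pay_result b i (pay_step b i (t, S, p, k, \<theta>, False))"
  unfolding pay_result_def by (subst while_unfold) simp

text \<open>One iteration integrates up to the next tie cost or the budget limit, a range in which
  no pending competitor precedes \<open>i\<close> and the share is just the offer. If the loop
  continues, the rest of the integral belongs to the run in which the head of the list has been
  served; if it exits, the share vanishes on the rest of the half-line.\<close>

lemma pay_result_eq_integral:
  assumes "pending m n \<kappa> u G b i y L" "k \<in> {1..n}" "descending b L"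
    and "\<And>l. l \<in> set L \<Longrightarrow> critical b i k \<le> critical b i l"
  shows "pay_result b i (y, set L, p, k, int (card (set L)), False) =
    p + (LBINT v = ereal (critical b i k)..\<infinity>. share b i y L v)"
  using assms
proof (induction L arbitrary: y p k)
  case Nil
  interpret pending m n \<kappa> u G b i y "[]" by (rule Nil.prems)
  let ?c = "critical b i k"
  have c: "0 < ?c"
    using Nil.prems(2) user value_positive[of i] value_positive[of k] valid_bid[of k]
    by (simp add: valid_bid_def)
  let ?f = "\<lambda>v. min (len (free b y i)) (of_int \<lfloor>G / (2 * v) - revenue y / \<mu> i\<rfloor>)"
  show ?case
  proof (cases "0 < len (free b y i) \<and> ereal ?c \<le> budget_limit")
    case True
    \<comment> \<open>With no competitor left the counter is 0, which admits one last iteration; it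
      integrates up to the budget limit and leaves the counter at -1.\<close>
    then have "pay_result b i (y, set [], p, k, int (card (set [])), False) =
        p + (LBINT v = ereal ?c..budget_limit. ?f v)"
      by (subst pay_result_step) (simp_all add: pay_step_def Let_def budget_limit_def del: times_divide_eq_left)
    also have "(LBINT v = ereal ?c..budget_limit. ?f v) = (LBINT v = ereal ?c..budget_limit. share b i y [] v)"
      using True c
      by (intro interval_integral_cong)
         (auto simp: einterval_iff min_def max_def share_def offer_within_budget simp del: times_divide_eq_left)
    also have "\<dots> = \<dots> + (LBINT v = budget_limit..\<infinity>. share b i y [] v)"
    proof -
      have "(LBINT v = budget_limit..\<infinity>. share b i y [] v) = 0"
      proof (rule interval_integral_to_infinity_zero)
        fix v assume v: "budget_limit < ereal v"
        with True have "?c < v"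
          by (meson ereal_less_eq(3) less_le_trans linorder_not_less order_trans less_imp_le not_le)
        with v c show "share b i y [] v = 0"
          by (intro share_eq_0_if_offer offer_beyond_budget) auto
      qed
      then show ?thesis by simp
    qed
    finally show ?thesis
      using True by (simp only: share_integral_split[OF c, of budget_limit])
  next
    case False
    then have "pay_result b i (y, set [], p, k, int (card (set [])), False) = p"
      by (subst pay_result_step) (auto simp add: pay_step_def Let_def budget_limit_def simp del: times_divide_eq_left)
    moreover have "(LBINT v = ereal ?c..\<infinity>. share b i y [] v) = 0"
    proof (rule interval_integral_to_infinity_zero)
      fix v assume v: "ereal ?c < ereal v"
      have "offer b i v y = 0"
      proof (cases "0 < len (free b y i)")
        case True
        with False v have "budget_limit < ereal v"
          by (meson less_trans not_le)
        with v c show ?thesis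
          by (intro offer_beyond_budget) auto
      qed (simp add: offer_def)
      with v c show "share b i y [] v = 0"
        by (intro share_eq_0_if_offer) auto
    qed
    ultimately show ?thesis by simp
  qed
next
  case (Cons j L)
  interpret pending m n \<kappa> u G b i y "j # L" by (rule Cons.prems)
  let ?c = "critical b i k" and ?d = "critical b i j"
  let ?e = "min (ereal ?d) budget_limit"
  have j: "j \<in> {1..n}" "y j = {}"
    using competitors vacant by auto
  have c: "0 < ?c"
    using Cons.prems(2) user value_positive[of i] value_positive[of k] valid_bid[of k]
    by (simp add: valid_bid_def)
  have cd: "?c \<le> ?d"
    using Cons.prems(4) by simp
  let ?f = "\<lambda>v. min (len (free b y i)) (of_int \<lfloor>G / (2 * v) - revenue y / \<mu> i\<rfloor>)"
  let ?q = "quota b y j" and ?Z = "free b y j"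
  note crit = outranked_iff_critical[of b j i, OF valid_bid[OF j(1)] user j(1)]
  show ?case
  proof (cases "0 < len (free b y i) \<and> ereal ?c \<le> ?e")
    case True
    let ?I = "LBINT v = ereal ?c..?e. ?f v"
    have "?I = (LBINT v = ereal ?c..?e. share b i y (j # L) v)"
    proof (rule interval_integral_cong)
      fix v assume "v \<in> einterval (min (ereal ?c) ?e) (max (ereal ?c) ?e)"
      then have v: "?c < v" "v < ?d" "ereal v < budget_limit"
        using True by (auto simp: einterval_iff min_absorb1 max_absorb2 simp del: times_divide_eq_left)
      \<comment> \<open>Below the tie cost the head of the list does not precede \<open>i\<close>,
        so \<open>takeWhile\<close> returns the empty list and the share is the offer at
        \<open>y\<close>.\<close>
      then have "\<not> outranked b i v j"
        using c by (intro crit) auto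
      with v c show "?f v = share b i y (j # L) v"
        by (simp add: share_def offer_within_budget)
    qed
    then have I: "(LBINT v = ereal ?c..\<infinity>. share b i y (j # L) v) =
        ?I + (LBINT v = ?e..\<infinity>. share b i y (j # L) v)"
      using True by (simp only: share_integral_split[OF c, of ?e])
    have cv: "?c < v" if "?e < ereal v" for v
      using True that by (metis le_less_trans less_ereal.simps(1))
    have step: "pay_result b i (y, set (j # L), p, k, int (card (set (j # L))), False) =
        pay_result b i
         (if ?q < len ?Z
          then (serve b y j, set (j # L), p + ?I, k, int (card (set (j # L))), True)
          else (serve b y j, set (j # L) - {j}, p + ?I, j, int (card (set (j # L))) - 1, False))"
    proof -
      have "pay_step b i (y, set (j # L), p, k, int (card (set (j # L))), False) =
         (if ?q < len ?Z
          then (serve b y j, set (j # L), p + ?I, k, int (card (set (j # L))), True)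
          else (serve b y j, set (j # L) - {j}, p + ?I, j, int (card (set (j # L))) - 1, False))"
        using True unfolding pay_step_def prod.case Let_def prec_max_hd[OF Cons.prems(3)]
          budget_limit_def serve_def by simp
      then show ?thesis
        by (subst pay_result_step) simp_all
    qed
    show ?thesis
    proof (cases "?q < len ?Z")
      case less: True
      have "(LBINT v = ?e..\<infinity>. share b i y (j # L) v) = 0"
      proof (rule interval_integral_to_infinity_zero)
        fix v assume ev: "?e < ereal v"
        with cv c have v: "0 < v" "?c < v" by force+
        \<comment> \<open>Beyond \<open>?e\<close> either the budget of \<open>i\<close> is
          exceeded, or \<open>j\<close> outranks \<open>i\<close> and has to be passed
          first.\<close>
        show "share b i y (j # L) v = 0"
        proof (cases "budget_limit < ereal v")
          case True
          with v show ?thesis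
            by (intro share_eq_0_if_offer offer_beyond_budget)
        next
          case False
          with ev have dv: "?d < v"
            by (simp add: min_less_iff_disj del: times_divide_eq_left)
          show ?thesis
          proof (cases "blocked b y j")
            case True
            with crit(1)[OF v(1) dv] show ?thesis
              by (simp add: share_def)
          next
            case False
            \<comment> \<open>Here CalPayment stops although ApproxMCS would go on; but no budget is left for \<open>i\<close>.\<close>
            with less have "len ?Z = 0" "?q < 0"
              by (auto simp: blocked_def len_def less_le)
            then have "G / (2 * cost (b j)) - revenue y / \<mu> j < 0"
              unfolding quota_def by (simp add: min_less_iff_disj)
            then have "\<mu> j * G / (2 * cost (b j)) < revenue y"
              using value_positive[OF j(1)] by (simp add: field_simps)
            moreover have "G / (2 * v) < G / (2 * ?d)"
            proof (rule divide_strict_left_mono)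
              show "2 * ?d < 2 * v"
                using dv by (rule mult_strict_left_mono) simp
              have "0 < ?d"
                using c cd by (rule less_le_trans)
              with v(1) show "0 < 2 * v * (2 * ?d)"
                by (intro mult_pos_pos[of "2 * v"] mult_pos_pos[of 2]) simp_all
            qed (rule budget_pos)
            \<comment> \<open>At the tie cost \<open>?d\<close> the budget tests of \<open>i\<close>
              and \<open>j\<close> are proportional: both compare \<open>revenue y\<close> with
              \<open>\<mu> j * G / (2 * cost (b j))\<close>. So the failure for \<open>j\<close>
              carries over to \<open>i\<close> at every higher cost.\<close>
            moreover have "G / (2 * ?d) = \<mu> j * G / (2 * cost (b j)) / \<mu> i"
              by (simp add: ac_simps)
            ultimately have "G / (2 * v) < revenue y / \<mu> i"
              using value_positive[OF user] by (smt (verit) divide_strict_right_mono)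
            then have "real_of_int \<lfloor>G / (2 * v) - revenue y / \<mu> i\<rfloor> < 0"
              by simp
            then have "offer b i v y = 0"
              unfolding offer_def by linarith
            with v show ?thesis
              by (intro share_eq_0_if_offer)
          qed
        qed
      qed
      with less show ?thesis
        by (simp only: step I if_True pay_result_halt)
    next
      case False
      then have q: "?q = len ?Z"
        using quota_le_len[of b y j] by simp
      then have nb: "\<not> blocked b y j"
        by (simp add: blocked_def)
      have "0 \<le> ?q"
        using q by (simp add: len_def)
      then have "0 \<le> \<lfloor>G / (2 * cost (b j)) - revenue y / \<mu> j\<rfloor>"
        by (simp add: quota_def del: zero_le_floor)
      then have R: "revenue y / \<mu> j \<le> G / (2 * cost (b j))"
        by simp
      \<comment> \<open>A quota equal to the free length is nonnegative, so \<open>j\<close> is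
        within the budget; by the same proportionality \<open>i\<close> is within it at the tie
        cost, and the integration reaches \<open>?d\<close>.\<close>
      have "ereal ?d \<le> budget_limit"
      proof (cases "revenue y = 0")
        case F: False
        then have "0 < revenue y"
          using revenue_nonneg[of y] by simp
        then have "?d \<le> \<mu> i * G / (2 * revenue y)"
          using R value_positive[OF user] value_positive[OF j(1)] valid_bid[OF j(1)]
          by (simp add: field_simps valid_bid_def)
        with F show ?thesis
          by (simp add: budget_limit_def)
      qed (simp add: budget_limit_def)
      then have e: "?e = ereal ?d"
        by (simp add: min_absorb1)
      \<comment> \<open>Above the tie cost \<open>j\<close> always precedes \<open>i\<close>, so
        serving him can be absorbed into the starting schedule.\<close>
      have "(LBINT v = ?e..\<infinity>. share b i y (j # L) v) = (LBINT v = ereal ?d..\<infinity>. share b i (serve b y j) L v)"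
        unfolding e
      proof (rule interval_integral_cong)
        fix v assume "v \<in> einterval (min (ereal ?d) \<infinity>) (max (ereal ?d) \<infinity>)"
        then have "?d < v"
          by (simp add: einterval_iff min_def)
        moreover from this have "0 < v"
          using c cd by linarith
        ultimately have "outranked b i v j"
          by (intro crit)
        with nb show "share b i y (j # L) v = share b i (serve b y j) L v"
          by (simp add: share_def)
      qed
      moreover have "pending m n \<kappa> u G b i (serve b y j) L"
      proof unfold_locales
        show "unit_schedule (serve b y j)"
          by (rule unit_schedule_serve[of y b j, OF unit_schedule valid_bid[OF j(1)]])
        show "serve b y j l = {}" if "l \<in> set L" for l
          using that vacant[of l] competitors(3) serve_other[of l j b y] by auto
      qed (use valid user competitors in auto)
      then have "pay_result b i (serve b y j, set L, p + ?I, j, int (card (set L)), False) =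
          p + ?I + (LBINT v = ereal ?d..\<infinity>. share b i (serve b y j) L v)"
      proof (rule Cons.IH[OF _ j(1)])
        show "descending b L"
          using Cons.prems(3) by simp
        show "?d \<le> critical b i l" if "l \<in> set L" for l
          using that Cons.prems(3) competitors(1) j(1) user by (intro critical_mono valid_bid) auto
      qed
      moreover have "set (j # L) - {j} = set L" "int (card (set (j # L))) - 1 = int (card (set L))"
        using competitors(3) by auto
      ultimately show ?thesis
        using False by (simp only: step I if_False add.assoc)
    qed
  next
    case False
    then have exit: "(0 < len (free b y i) \<and>
        ereal ?c \<le> (if set (j # L) \<noteq> {} then ?e else budget_limit)) = False"
      by simp
    have "pay_step b i (y, set (j # L), p, k, int (card (set (j # L))), False) =
       (y, set (j # L), p, k, int (card (set (j # L))), True)"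
      unfolding pay_step_def prod.case Let_def prec_max_hd[OF Cons.prems(3)]
        budget_limit_def[symmetric] by (simp only: exit if_False)
    then have "pay_result b i (y, set (j # L), p, k, int (card (set (j # L))), False) = p"
      by (subst pay_result_step) simp_all
    moreover have "(LBINT v = ereal ?c..\<infinity>. share b i y (j # L) v) = 0"
    proof (rule interval_integral_to_infinity_zero)
      fix v assume v: "ereal ?c < ereal v"
      have "offer b i v y = 0"
      proof (cases "0 < len (free b y i)")
        case True
        have "ereal ?c \<le> ereal ?d"
          using cd by (simp del: times_divide_eq_left)
        with False True have "budget_limit < ereal ?c"
          by (auto simp: min_def not_le split: if_splits simp del: times_divide_eq_left ereal_less_eq less_ereal.simps)
        with v have "budget_limit < ereal v"
          by (rule less_trans[rotated])
        with v c show ?thesis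
          by (intro offer_beyond_budget) auto
      qed (simp add: offer_def)
      with v c show "share b i y (j # L) v = 0"
        by (intro share_eq_0_if_offer) auto
    qed
    ultimately show ?thesis by simp
  qed
qed

end

context pending
begin

text \<open>\<open>share\<close> is decreasing, hence its tail integral is convex in \<open>c\<close> with slope \<open>- share d\<close> at \<open>d\<close>.\<close>

lemma share_integral_tangent:
  assumes "0 < c" "0 < d"
  shows "(d - c) * share b i y L d + (LBINT v = ereal d..\<infinity>. share b i y L v)
    \<le> (LBINT v = ereal c..\<infinity>. share b i y L v)"
proof -
  let ?f = "share b i y L"
  have int: "set_integrable lborel {p<..<q} ?f" if "0 < p" for p q
    by (rule set_integrable_subset[OF share_integrable[OF that]]) auto
  have const: "set_integrable lborel {p<..<q} (\<lambda>_. ?f d)" for p q :: real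
    unfolding set_integrable_def
    by (intro integrable_scaleR_left integrable_real_indicator emeasure_bounded_finite) auto
  have cint: "(LBINT v:{p<..<q}. ?f d) = (q - p) * ?f d" if "p \<le> q" for p q :: real
    using that by (simp add: set_lebesgue_integral_def)
  have split: "(LBINT v = ereal p..\<infinity>. ?f v) = (LBINT v:{p<..<q}. ?f v) + (LBINT v = ereal q..\<infinity>. ?f v)"
    if "0 < p" "p \<le> q" for p q
    using that share_integral_split[of p q] by (simp add: interval_lebesgue_integral_le_eq)
  show ?thesis
  proof (cases "c \<le> d")
    case True
    have "(LBINT v:{c<..<d}. ?f d) \<le> (LBINT v:{c<..<d}. ?f v)"
      by (intro set_integral_mono const int assms) (use assms in \<open>auto intro!: share_antimono\<close>)
    then show ?thesis
      using split[of c d] cint[of c d] True assms by simp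
  next
    case False
    have "(LBINT v:{d<..<c}. ?f v) \<le> (LBINT v:{d<..<c}. ?f d)"
      by (intro set_integral_mono const int assms) (use assms in \<open>auto intro!: share_antimono\<close>)
    then show ?thesis
      using split[of d c] cint[of d c] False assms by (simp add: left_diff_distrib)
  qed
qed

lemma share_integral_nonneg: "0 \<le> (LBINT v = ereal c..\<infinity>. share b i y L v)"
  by (auto simp: interval_lebesgue_integral_le_eq set_lebesgue_integral_def share_nonneg
      intro!: Bochner_Integration.integral_nonneg)

end

context mcs
begin

subsection \<open>Outcome of the greedy branch for a single user\<close>

lemma offer_eq_quota: "offer b i (cost (b i)) t = max 0 (quota b t i)"
  by (simp add: offer_def quota_def)

lemma pending_start:
  assumes "valid_bids n b" "i \<in> {1..n}" "set L = {1..n} - {i}" "distinct L"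
  shows "pending m n \<kappa> u G b i (\<lambda>_. {}) L"
  by unfold_locales (use assms unit_schedule_empty in auto)

text \<open>The cost of \<open>i\<close> splits \<open>L\<close> into the users \<open>A\<close>
  before him and \<open>B\<close> after him. The run over \<open>A\<close> decides his allocation,
  and CalPayment resumes from its schedule with \<open>B\<close> pending. The last conclusion keeps
  the schedule he meets, which is needed to compare windows.\<close>

lemma greedy_branch_outcome:
  assumes "valid_bids n b" "i \<in> {1..n}" "set L = {1..n} - {i}" "distinct L" "descending b L"
  defines "x \<equiv> share b i (\<lambda>_. {}) L" and "d \<equiv> cost (b i)"
  shows "len (fst (greedy_branch b) i) = x d"
    and "snd (greedy_branch b) i = (if 0 < x d then d * x d + (LBINT v = ereal d..\<infinity>. x v) else 0)"
    and "0 < x d \<Longrightarrow> \<exists>t. pass b (\<lambda>_. {}) (takeWhile (outranked b i d) L) = Some t \<and> 0 < quota b t i \<and>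
      fst (greedy_branch b) i = first_units (quota b t i) (free b t i)"
proof -
  interpret pending m n \<kappa> u G b i "\<lambda>_. {}" L
    by (rule pending_start) (fact assms)+
  define A B where "A = takeWhile (prec b i) L" and "B = dropWhile (prec b i) L"
  have L: "L = A @ B" and A: "A = takeWhile (outranked b i d) L"
    by (simp_all add: A_def B_def prec_eq_outranked d_def)
  have desc: "descending b (A @ i # B)"
    unfolding A_def B_def by (rule descending_insert[OF assms(5) competitors(2)])
  have dist: "distinct (A @ i # B)"
    using competitors(2,3) unfolding L by auto
  have users: "set (A @ i # B) = {1..n}"
  proof -
    have "set (A @ i # B) = insert i (set L)"
      by (simp add: L)
    with assms(2,3) show ?thesis
      by (simp only: insert_Diff)
  qed
  define Y W where "Y = fst (greedy b (\<lambda>_. {}) [] (A @ i # B))"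
    and "W = snd (greedy b (\<lambda>_. {}) [] (A @ i # B))"
  have gb: "greedy_branch b = (Y, \<lambda>i. if i \<in> set W then cal_payment b Y W i else 0)"
    unfolding greedy_branch_def approx_mcs_eq_greedy[OF assms(1) desc dist users] Y_def W_def
    by (simp add: split_beta)
  note at = greedy_at[where b = b and y = "\<lambda>_. {}" and W = "[]", OF dist, folded Y_def W_def]
  have "len (fst (greedy_branch b) i) = x d \<and>
    snd (greedy_branch b) i = (if 0 < x d then d * x d + (LBINT v = ereal d..\<infinity>. x v) else 0) \<and>
    (0 < x d \<longrightarrow> (\<exists>t. pass b (\<lambda>_. {}) (takeWhile (outranked b i d) L) = Some t \<and> 0 < quota b t i \<and>
      fst (greedy_branch b) i = first_units (quota b t i) (free b t i)))"
  proof (cases "pass b (\<lambda>_. {}) A")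
    case None
    with at have "i \<notin> set W" "Y i = {}" by auto
    moreover have "x d = 0"
      using None by (simp add: x_def share_def A)
    ultimately show ?thesis
      by (simp add: gb len_def)
  next
    case (Some t)
    have x: "x d = max 0 (quota b t i)"
      using Some by (simp add: x_def share_def A[unfolded d_def, symmetric] d_def offer_eq_quota)
    note t = pass_prefix_ge[OF Some L]
    show ?thesis
    proof (cases "0 < quota b t i")
      case False
      with at Some have "i \<notin> set W" "Y i = {}" by auto
      with False x show ?thesis
        by (simp add: gb len_def)
    next
      case True
      with at Some have W: "i \<in> set W" and Y: "Y i = first_units (quota b t i) (free b t i)"
        and t_eq: "(\<lambda>l. if l \<in> set (takeWhile (\<lambda>l. l \<noteq> i) W) then Y l else {}) = t"
        by auto
      have len: "len (Y i) = x d"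
        unfolding Y using True x len_first_units[of t b i] t(2) valid_bid user by simp
      have "{j \<in> {1..n}. prec b j i} = set B"
      proof -
        have "\<And>j. j \<in> set A \<Longrightarrow> prec b i j" "\<And>j. j \<in> set B \<Longrightarrow> prec b j i"
          using desc by (auto simp: sorted_wrt_append)
        then show ?thesis
          unfolding users[symmetric] using prec_irrefl prec_trans by (auto; metis)
      qed
      then have "cal_payment b Y W i = pay_result b i (t, set B, d * x d, i, int (card (set B)), False)"
        by (simp add: cal_payment_def pay_result_def t_eq len d_def Let_def split_beta)
      also have "\<dots> = d * x d + (LBINT v = ereal (critical b i i)..\<infinity>. share b i t B v)"
      proof (rule pay_result_eq_integral)
        show "pending m n \<kappa> u G b i t B"
          by unfold_locales (use valid user competitors t L in auto)
        show "descending b B"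
          using assms(5) unfolding L by (simp add: sorted_wrt_append)
        show "critical b i i \<le> critical b i l" if "l \<in> set B" for l
        proof (rule critical_mono)
          show "prec b l i"
            using desc that by (auto simp: sorted_wrt_append)
          show "l \<in> {1..n}"
            using that users by auto
          then show "Defs.valid_bid (b l)"
            by (rule valid_bid)
        qed (use user valid_bid in auto)
      qed (rule user)
      also have "critical b i i = d"
        using value_positive[OF user] by (simp add: d_def)
      \<comment> \<open>Whoever outranks \<open>i\<close> at cost \<open>d\<close> also does so at
        higher costs, so for \<open>v > d\<close> the run over \<open>L\<close> begins with all of
        \<open>A\<close> and passes through \<open>t\<close>.\<close>
      also have "(LBINT v = ereal d..\<infinity>. share b i t B v) = (LBINT v = ereal d..\<infinity>. x v)"
      proof (rule interval_integral_cong)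
        fix v assume "v \<in> einterval (min (ereal d) \<infinity>) (max (ereal d) \<infinity>)"
        then have "d < v"
          by (simp add: einterval_iff min_def)
        moreover have "0 < d"
          using valid_bid[OF user] by (simp add: d_def valid_bid_def)
        ultimately have "outranked b i v j" if "j \<in> set A" for j
          using that user unfolding A by (auto dest!: set_takeWhileD intro: outranked_mono[of d v])
        then have "takeWhile (outranked b i v) L = A @ takeWhile (outranked b i v) B"
          unfolding L by (intro takeWhile_append2) auto
        with Some show "share b i t B v = x v"
          by (simp add: x_def share_def pass_append)
      qed
      finally show ?thesis
        using W Y True x len Some A by (simp add: gb)
    qed
  qed
  then show "len (fst (greedy_branch b) i) = x d"
    "snd (greedy_branch b) i = (if 0 < x d then d * x d + (LBINT v = ereal d..\<infinity>. x v) else 0)"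
    "0 < x d \<Longrightarrow> \<exists>t. pass b (\<lambda>_. {}) (takeWhile (outranked b i d) L) = Some t \<and> 0 < quota b t i \<and>
      fst (greedy_branch b) i = first_units (quota b t i) (free b t i)"
    by blast+
qed

subsection \<open>Truthfulness\<close>

text \<open>
  The first unit assigned at \<open>t\<close> lies in \<open>window \<theta>\<close>, so no unit of the declared window before the
  true arrival is still free, neither at \<open>t\<close> nor at the later schedule \<open>t'\<close>.
\<close>

lemma len_free_misreport:
  assumes "t \<le> t'" "unit_schedule t" "unit_schedule t'" "valid_bid (b i)" "valid_bid \<theta>"
    and "0 < quota b t i" "first_units (quota b t i) (free b t i) \<sqsubseteq> window \<theta>"
    and "real_of_int (departure (b i)) \<in> window \<theta>"
  shows "len (free b t' i) \<le> len (free (b(i := \<theta>)) t' i)"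
proof (rule quota_nat[OF assms(2,4,6)])
  fix k T
  let ?F = "{arrival (b i)..<departure (b i)} - T"
  assume T: "quota b t i = real k" "covered t (\<kappa> i) = units T"
    and fu: "first_units (quota b t i) (free b t i) = units (first_elems k ?F)"
  have "units (first_elems k ?F) \<sqsubseteq> units {arrival \<theta>..<departure \<theta>}"
    using assms(5,7) by (simp add: fu window_units)
  then have first: "first_elems k ?F \<subseteq> {arrival \<theta>..<departure \<theta>}"
    by (rule ess_subset_unitsD)
  \<comment> \<open>Payment happens at the declared departure, so being present to collect it
    excludes too late a declaration.\<close>
  have dep: "departure (b i) \<le> departure \<theta>"
    using assms(8) by (simp add: window_def)
  obtain T' where T': "finite T'" "covered t' (\<kappa> i) = units T'"
    by (rule covered_units[OF assms(3)])
  have "units T \<subseteq> units T'"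
    using covered_mono[OF assms(1)] T(2) T'(2) by metis
  then have "T \<subseteq> T'"
    by (rule units_subsetD)
  have "{arrival (b i)..<departure (b i)} - T' \<subseteq> {arrival \<theta>..<departure \<theta>} - T'"
  proof
    fix s assume s: "s \<in> {arrival (b i)..<departure (b i)} - T'"
    then have "s \<in> ?F"
      using \<open>T \<subseteq> T'\<close> by auto
    then obtain r where "r \<in> first_elems k ?F" "r \<le> s"
      using first_elems_least[of k s ?F] assms(6) T(1) by auto
    with first dep s show "s \<in> {arrival \<theta>..<departure \<theta>} - T'"
      by auto
  qed
  then have "card ({arrival (b i)..<departure (b i)} - T') \<le> card ({arrival \<theta>..<departure \<theta>} - T')"
    by (intro card_mono) auto
  then show ?thesis
    using assms(4,5) by (simp add: free_def window_units T'(2) len_units_diff)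
qed

lemma greedy_branch_truthful: "truthful n greedy_branch"
  unfolding truthful_def
proof (intro allI impI)
  fix b i \<theta>
  assume b: "valid_bids n b" and i: "i \<in> {1..n}" and \<theta>: "valid_bid \<theta>"
  define b' where "b' = b(i := \<theta>)"
  have b': "valid_bids n b'" "b' i = \<theta>"
    using b \<theta> by (auto simp: valid_bids_def b'_def)
  obtain L where L: "set L = {1..n} - {i}" "distinct L" "descending b L"
    by (rule descending_exists[of "{1..n} - {i}" b]) auto
  have same: "b' j = b j" if "j \<in> set L" for j
    using that L(1) by (auto simp: b'_def)
  \<comment> \<open>The bid of \<open>i\<close> does not affect the order among the others, so one
    list serves both reports.\<close>
  have L': "descending b' L"
    using L(3) by (rule sorted_wrt_mono_rel[rotated]) (simp add: prec_def same)
  interpret pending m n \<kappa> u G b i "\<lambda>_. {}" L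
    by (rule pending_start) (fact b i L)+
  interpret true: pending m n \<kappa> u G b' i "\<lambda>_. {}" L
    by (rule pending_start) (fact b' i L)+
  let ?x = "share b i (\<lambda>_. {}) L" and ?x' = "share b' i (\<lambda>_. {}) L"
  let ?d = "cost (b i)" and ?c = "cost \<theta>"
  let ?I = "\<lambda>c. LBINT v = ereal c..\<infinity>. ?x v" and ?I' = "\<lambda>c. LBINT v = ereal c..\<infinity>. ?x' v"
  have d: "0 < ?d" and c: "0 < ?c"
    using valid_bid[OF i] \<theta> by (simp_all add: valid_bid_def)
  note out = greedy_branch_outcome[OF b i L]
  note out' = greedy_branch_outcome[OF b'(1) i L(1,2) L', unfolded b'(2)]
  have tw: "takeWhile (outranked b' i v) L = takeWhile (outranked b i v) L" for v
    by (intro takeWhile_cong refl) (simp add: outranked_def same)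
  have pass': "pass b' y (takeWhile (outranked b i v) L) = pass b y (takeWhile (outranked b i v) L)" for y v
    by (intro pass_cong same) (auto dest: set_takeWhileD)
  have truth: "utility greedy_branch i \<theta> b' = ?I' ?c"
  proof (cases "0 < ?x' ?c")
    case True
    then obtain t where t: "pass b' (\<lambda>_. {}) (takeWhile (outranked b' i ?c) L) = Some t"
        "0 < quota b' t i" "fst (greedy_branch b') i = first_units (quota b' t i) (free b' t i)"
      using out'(3) by blast
    have us: "unit_schedule t"
      by (rule true.pass_prefix_ge(2)[OF t(1) takeWhile_dropWhile_id[symmetric]])
    have "fst (greedy_branch b') i \<sqsubseteq> window \<theta>"
    proof (rule quota_nat[OF us true.valid_bid[OF i] t(2)])
      fix k T
      assume "first_units (quota b' t i) (free b' t i) =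
        units (first_elems k ({arrival (b' i)..<departure (b' i)} - T))"
      then show ?thesis
        using units_ess_subset[of "first_elems k ({arrival \<theta>..<departure \<theta>} - T)"
            "{arrival \<theta>..<departure \<theta>}" "{}"] first_elems_subset
        by (fastforce simp: t(3) b'(2) window_units[OF \<theta>])
    qed
    moreover have "real_of_int (departure \<theta>) \<in> window \<theta>"
      using \<theta> by (simp add: window_def valid_bid_def)
    ultimately have "received greedy_branch i \<theta> b' = ?c * ?x' ?c + ?I' ?c"
      using True by (simp add: received_def split_beta b'(2) out'(2))
    then show ?thesis
      by (simp add: utility_def out'(1))
  next
    case False
    then have "?x' ?c = 0"
      using share_nonneg[of b' i "\<lambda>_. {}" L ?c] by simp
    \<comment> \<open>A decreasing nonnegative curve that vanishes at the true cost vanishes from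
      there on, so the tail integral agrees with the utility 0 of an unselected user.\<close>
    then have "?x' v = 0" if "?c < v" for v
      using true.share_antimono[OF c, of v] that share_nonneg[of b' i "\<lambda>_. {}" L v] by simp
    then have "?I' ?c = 0"
      by (intro interval_integral_to_infinity_zero) simp
    then show ?thesis
      using \<open>?x' ?c = 0\<close> by (simp add: utility_def received_def split_beta out'(1,2))
  qed
  have "utility greedy_branch i \<theta> b \<le> ?I' ?c"
  proof (cases "0 < ?x ?d \<and> fst (greedy_branch b) i \<sqsubseteq> window \<theta> \<and> real_of_int (departure (b i)) \<in> window \<theta>")
    case False
    \<comment> \<open>Without a payment only the cost of sensing remains, so the utility is at most
      0, while the tail integral is nonnegative.\<close>
    then have "received greedy_branch i \<theta> b = 0"
      by (auto simp: received_def split_beta out(2))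
    moreover have "0 \<le> ?c * ?x ?d"
      using c share_nonneg[of b i "\<lambda>_. {}" L ?d] by simp
    ultimately show ?thesis
      using true.share_integral_nonneg[of ?c] by (simp add: utility_def out(1))
  next
    case True
    then obtain t where t: "pass b (\<lambda>_. {}) (takeWhile (outranked b i ?d) L) = Some t"
        "0 < quota b t i" "first_units (quota b t i) (free b t i) \<sqsubseteq> window \<theta>"
      using out(3) by metis
    \<comment> \<open>The condition \<open>?d \<le> v\<close> makes the schedule met at
      \<open>v\<close> an extension of \<open>t\<close>, as the comparison of the two windows
      requires.\<close>
    have le: "?x v \<le> ?x' v" if dv: "?d \<le> v" for v
    proof (cases "pass b (\<lambda>_. {}) (takeWhile (outranked b i v) L)")
      case None
      then show ?thesis
        using share_nonneg[of b' i "\<lambda>_. {}" L v] by (simp add: share_def)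
    next
      case (Some t')
      then obtain "t \<le> t'" "unit_schedule t" "unit_schedule t'"
        using pass_outranked_mono[OF d dv Some] t(1) by (metis option.inject)
      then have "len (free b t' i) \<le> len (free b' t' i)"
        unfolding b'_def using t(2,3) valid_bid[OF i] \<theta> conjunct2[OF conjunct2[OF True]]
        by (intro len_free_misreport)
      then have "offer b i v t' \<le> offer b' i v t'"
        unfolding offer_def by (intro max.mono min.mono) auto
      with Some show ?thesis
        by (simp add: share_def tw pass')
    qed
    have I_le: "?I e \<le> ?I' e" if "?d \<le> e" for e
    proof -
      have "einterval (ereal e) \<infinity> = {e<..}"
        by (auto simp: einterval_iff)
      moreover have "(LBINT v:{e<..}. ?x v) \<le> (LBINT v:{e<..}. ?x' v)"
        using that d by (intro set_integral_mono share_integrable true.share_integrable le) auto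
      ultimately show ?thesis
        by (simp add: interval_lebesgue_integral_le_eq)
    qed
    have "utility greedy_branch i \<theta> b = (?d - ?c) * ?x ?d + ?I ?d"
      using True by (simp add: utility_def received_def split_beta out(1,2) left_diff_distrib)
    also have "\<dots> \<le> ?I' ?c"
    \<comment> \<open>The curves are comparable only from \<open>?d\<close> on. If
      \<open>?c \<le> ?d\<close>, the factor \<open>?d - ?c\<close> is nonnegative, so
      \<open>?x\<close> is replaced by \<open>?x'\<close> at \<open>?d\<close> and the tangent
      inequality is used for \<open>?x'\<close>. Otherwise the tangent inequality for
      \<open>?x\<close> moves to \<open>?c\<close>, beyond \<open>?d\<close>, where the tails can be
      compared.\<close>
    proof (cases "?c \<le> ?d")
      case True
      then have "(?d - ?c) * ?x ?d + ?I ?d \<le> (?d - ?c) * ?x' ?d + ?I' ?d"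
        by (intro add_mono mult_left_mono le I_le) auto
      also have "\<dots> \<le> ?I' ?c"
        by (rule true.share_integral_tangent[OF c d])
      finally show ?thesis .
    next
      case False
      have "(?d - ?c) * ?x ?d + ?I ?d \<le> ?I ?c"
        by (rule share_integral_tangent[OF c d])
      also have "\<dots> \<le> ?I' ?c"
        using False by (intro I_le) simp
      finally show ?thesis .
    qed
    finally show ?thesis .
  qed
  with truth show "utility greedy_branch i \<theta> b \<le> utility greedy_branch i \<theta> (b(i := \<theta>))"
    by (simp add: b'_def)
qed

section \<open>The branch that selects a single user\<close>

lemma len_time_unit: "len (time_unit t) = 1"
  by (simp add: len_def time_unit_def)

text \<open>This is a posted price \<open>G\<close> for one unit. A report of \<open>i\<close>
  influences whether he wins only through \<open>cost \<le> G\<close>: the candidates are ranked by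
  \<open>\<mu>\<close>, and \<open>tie\<close> sees nothing but their set. An eligible truthful user
  therefore wins whenever some report wins, and an ineligible one would lose by winning. The slot
  may vary with the bids, but a truthful winner can always serve it and is paid.\<close>

lemma single_branch_truthful:
  assumes tie: "\<And>A. A \<subseteq> {1..n} \<Longrightarrow> A \<noteq> {} \<Longrightarrow> tie A \<in> A"
    and slot: "\<And>b j. valid_bids n b \<Longrightarrow> j \<in> {1..n} \<Longrightarrow> time_unit (slot b j) \<subseteq> window (b j)"
  shows "truthful n (single_branch tie slot)"
  unfolding truthful_def
proof (intro allI impI)
  fix b i \<theta>
  assume b: "valid_bids n b" and i: "i \<in> {1..n}" and \<theta>: "valid_bid \<theta>"
  let ?M = "single_branch tie slot" and ?b = "b(i := \<theta>)"
  define A where "A b = {i. is_arg_max \<mu> (\<lambda>i. i \<in> {1..n} \<and> cost (b i) \<le> G) i}" for b :: bids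
  define win where "win b \<longleftrightarrow> A b \<noteq> {} \<and> tie (A b) = i" for b
  have A_sub: "A b \<subseteq> {1..n}" for b
    by (auto simp: A_def is_arg_max_def)
  have eligible: "cost (b i) \<le> G" if "win b" for b
    using that tie[OF A_sub] by (auto simp: win_def A_def is_arg_max_def)
  have M: "?M b = (if A b = {} then (\<lambda>_. {}, \<lambda>_. 0)
      else ((\<lambda>_. {})(tie (A b) := time_unit (slot b (tie (A b)))), (\<lambda>_. 0)(tie (A b) := G)))" for b
    by (simp only: single_branch_def A_def Let_def)
  have lose: "utility ?M i \<theta> b = 0" if "\<not> win b" for b
    using that by (auto simp: utility_def received_def M win_def len_def)
  have upper: "utility ?M i \<theta> b \<le> G - cost \<theta>" if "win b" for b
    using that budget_pos by (auto simp: utility_def received_def M win_def len_time_unit)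
  have b': "valid_bids n ?b"
    using b \<theta> by (auto simp: valid_bids_def)
  have truth: "utility ?M i \<theta> ?b = G - cost \<theta>" if "win ?b"
  proof -
    have "time_unit (slot ?b i) \<sqsubseteq> window \<theta>"
      using slot[OF b' i] by (simp add: ess_subset_def Diff_eq_empty_iff[THEN iffD2])
    moreover have "real_of_int (departure \<theta>) \<in> window \<theta>"
      using \<theta> by (simp add: window_def valid_bid_def)
    ultimately show ?thesis
      using that by (auto simp: utility_def received_def M win_def len_time_unit)
  qed
  have "0 \<le> utility ?M i \<theta> ?b"
    using truth lose eligible[of ?b] by (cases "win ?b") auto
  show "utility ?M i \<theta> b \<le> utility ?M i \<theta> ?b"
  proof (cases "win b")
    case False
    with lose \<open>0 \<le> utility ?M i \<theta> ?b\<close> show ?thesis by simp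
  next
    case True
    show ?thesis
    proof (cases "cost \<theta> \<le> G")
      case le: True
      have "A ?b = A b"
        unfolding A_def using le eligible[OF True] by (intro Collect_cong arg_cong[where f = "\<lambda>P. is_arg_max \<mu> P _"]) auto
      with True have "win ?b" by (simp add: win_def)
      with truth upper[OF True] show ?thesis by simp
    next
      case False
      with upper[OF True] \<open>0 \<le> utility ?M i \<theta> ?b\<close> show ?thesis by simp
    qed
  qed
qed

end

theorem theorem6:
  fixes m n :: nat and \<kappa> :: "nat \<Rightarrow> nat" and u :: "nat \<Rightarrow> real" and G :: real
    and tie :: "nat set \<Rightarrow> nat" and slot :: "bids \<Rightarrow> nat \<Rightarrow> int"
  assumes "mcs m n \<kappa> u G"
    and "\<And>A. A \<subseteq> {1..n} \<Longrightarrow> A \<noteq> {} \<Longrightarrow> tie A \<in> A"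
    and "\<And>b j. valid_bids n b \<Longrightarrow> j \<in> {1..n} \<Longrightarrow> time_unit (slot b j) \<subseteq> window (b j)"
  shows "universally_truthful n (mcs.offline_mechanism m n \<kappa> u G tie slot)"
proof -
  interpret mcs m n \<kappa> u G by fact
  have "truthful n (single_branch tie slot)"
    using assms(2,3) by (rule single_branch_truthful)
  with greedy_branch_truthful show ?thesis
    unfolding universally_truthful_def offline_mechanism_def by auto
qed

end
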